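(* Let $\mathbf K=\mathbf H$ or $\mathbf K=\mathbf O$, let $X$ be a Hilbert space over $\mathbf K$, and let $\mathcal C$ be a selfadjoint $C^*$-algebra of operators contained in $L_q(X)$. Let $cl_s$ denote closure in $L_q(X)$ relative to the strong operator topology, and let $B(Y,0,1)$ denote the ball of unit radius with centre at zero in $Y$. Then for each $T\in B(cl_s(\mathcal C),0,1)$ one has $T\in cl_s(B(\mathcal C,0,1))$. If an operator $T\in B(cl_s(\mathcal C),0,1)$ is selfadjoint, then $T$ belongs to the strong operator closure of the set of selfadjoint operators from $B(\mathcal C,0,1)$.
   Context: $\mathbf H$ denotes the quaternions and $\mathbf O$ the octonions, regarded as real algebras with conjugation $z\mapsto\tilde z$, norm $|z|=(z\tilde z)^{1/2}$ and standard generators $i_0=1,i_1,\dots,i_m$, where $m=3$ for $\mathbf H$ and $m=7$ for $\mathbf O$. $\mathbf K$-vector spaces: additive groups with left and right multiplication by scalars of $\mathbf K$, distributive on both sides, with $a(bv)=(ab)v$, $(vb)a=v(ba)$ if $\mathbf K=\mathbf H$, respectively $b(bv)=b^2v$, $(vb)b=vb^2$ if $\mathbf K=\mathbf O$; such a space decomposes as $X=X_0\oplus X_1i_1\oplus\dots\oplus X_mi_m$ with $X_0,\dots,X_m$ pairwise isomorphic real vector spaces whose elements commute with scalars. A Hilbert space over $\mathbf K$ is such an $X$ with a biadditive, $\mathbf R$-bilinear map $\langle\cdot,\cdot\rangle:X^2\to\mathbf K$ with $\langle x,x\rangle\ge0$ real, $=0$ only for $x=0$; $\langle x,y\rangle=\langle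 y,x\rangle^{\sim}$; $\langle xa,yb\rangle=\tilde a\langle x,y\rangle b$ if $\mathbf K=\mathbf H$, $\langle xa,x\rangle=\tilde a\langle x,x\rangle$ if $\mathbf K=\mathbf O$; $\langle x_p,y_q\rangle\in\mathbf R$ and $\langle x_pi_p,y_qi_q\rangle=\langle x_p,y_q\rangle\tilde i_pi_q$ for $x_p\in X_p,y_q\in X_q$; complete in the norm $\|x\|=\langle x,x\rangle^{1/2}$. $L_q(X)$ is the algebra (under composition, with operator norm, $(bT)(x)=b(T(x))$, $(Tb)(x)=(T(x))b$) of bounded additive $\mathbf R$-homogeneous ("quasilinear") maps $X\to X$, with involution $\langle Tx,y\rangle=\langle x,T^*y\rangle$; $T$ is selfadjoint if $T=T^*$. A $C^*$-algebra over $\mathbf K$ is a unital Banach algebra over $\mathbf K$ with involution ($(\alpha T)^*=T^*\tilde\alpha$, $(TV)^*=V^*T^*$, etc.) and $\|x^*x\|=\|x\|^2$; a family of operators is selfadjoint if it is closed under $*$. The strong operator topology on $L_q(X)$ is generated by the sets $\{B:\|(B-A)x_j\|<b,\ j=1,\dots,n\}$, $b>0$, $x_j\in X$. $B(Y,0,1)=\{T\in Y:\|T\|\le1\}$. *)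

theory Defs
  imports "HOL-Analysis.Analysis"
begin

section \<open>Quaternions and octonions\<close>

text \<open>The common signature of the two scalar algebras.  Octonion multiplication is not
  associative, so the ring classes of the library cannot be used.  The list \<open>gens\<close> consists of
  the standard generators $i_0 = 1, i_1, \dots, i_m$.\<close>

class hypercomplex = real_vector + one + times +
  fixes hconj :: "'a \<Rightarrow> 'a"
    and hre :: "'a \<Rightarrow> real"
    and gens :: "'a list"

datatype quat = Quat (q0: real) (q1: real) (q2: real) (q3: real)

instantiation quat :: hypercomplex
begin

definition zero_quat :: quat where "0 = Quat 0 0 0 0"
definition one_quat :: quat where "1 = Quat 1 0 0 0"
definition plus_quat :: "quat \<Rightarrow> quat \<Rightarrow> quat" where
  "x + y = Quat (q0 x + q0 y) (q1 x + q1 y) (q2 x + q2 y) (q3 x + q3 y)"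
definition uminus_quat :: "quat \<Rightarrow> quat" where
  "- x = Quat (- q0 x) (- q1 x) (- q2 x) (- q3 x)"
definition minus_quat :: "quat \<Rightarrow> quat \<Rightarrow> quat" where
  "x - y = Quat (q0 x - q0 y) (q1 x - q1 y) (q2 x - q2 y) (q3 x - q3 y)"
definition scaleR_quat :: "real \<Rightarrow> quat \<Rightarrow> quat" where
  "r *\<^sub>R x = Quat (r * q0 x) (r * q1 x) (r * q2 x) (r * q3 x)"
definition times_quat :: "quat \<Rightarrow> quat \<Rightarrow> quat" where
  "x * y = Quat
     (q0 x * q0 y - q1 x * q1 y - q2 x * q2 y - q3 x * q3 y)
     (q0 x * q1 y + q1 x * q0 y + q2 x * q3 y - q3 x * q2 y)
     (q0 x * q2 y - q1 x * q3 y + q2 x * q0 y + q3 x * q1 y)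
     (q0 x * q3 y + q1 x * q2 y - q2 x * q1 y + q3 x * q0 y)"
definition hconj_quat :: "quat \<Rightarrow> quat" where
  "hconj x = Quat (q0 x) (- q1 x) (- q2 x) (- q3 x)"
definition hre_quat :: "quat \<Rightarrow> real" where "hre x = q0 x"
definition gens_quat :: "quat list" where
  "gens = [Quat 1 0 0 0, Quat 0 1 0 0, Quat 0 0 1 0, Quat 0 0 0 1]"

instance
  by standard
    (simp_all add: zero_quat_def plus_quat_def uminus_quat_def minus_quat_def scaleR_quat_def
      algebra_simps quat.expand)

end

lemmas quat_ops = zero_quat_def one_quat_def plus_quat_def uminus_quat_def minus_quat_def
  scaleR_quat_def times_quat_def hconj_quat_def hre_quat_def

text \<open>Cayley--Dickson doubling: \<open>Oct a b\<close> is $a + b\,l$ with $l = i_4$.\<close>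

datatype oct = Oct (o0: quat) (o1: quat)

instantiation oct :: hypercomplex
begin

definition zero_oct :: oct where "0 = Oct 0 0"
definition one_oct :: oct where "1 = Oct 1 0"
definition plus_oct :: "oct \<Rightarrow> oct \<Rightarrow> oct" where "x + y = Oct (o0 x + o0 y) (o1 x + o1 y)"
definition uminus_oct :: "oct \<Rightarrow> oct" where "- x = Oct (- o0 x) (- o1 x)"
definition minus_oct :: "oct \<Rightarrow> oct \<Rightarrow> oct" where "x - y = Oct (o0 x - o0 y) (o1 x - o1 y)"
definition scaleR_oct :: "real \<Rightarrow> oct \<Rightarrow> oct" where
  "r *\<^sub>R x = Oct (r *\<^sub>R o0 x) (r *\<^sub>R o1 x)"
definition times_oct :: "oct \<Rightarrow> oct \<Rightarrow> oct" where
  "x * y = Oct (o0 x * o0 y - hconj (o1 y) * o1 x) (o1 y * o0 x + o1 x * hconj (o0 y))"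
definition hconj_oct :: "oct \<Rightarrow> oct" where "hconj x = Oct (hconj (o0 x)) (- o1 x)"
definition hre_oct :: "oct \<Rightarrow> real" where "hre x = hre (o0 x)"
definition gens_oct :: "oct list" where
  "gens = map (\<lambda>a. Oct a 0) gens @ map (\<lambda>a. Oct 0 a) gens"

instance
  by standard
    (simp_all add: zero_oct_def plus_oct_def uminus_oct_def minus_oct_def scaleR_oct_def
      algebra_simps oct.expand)

end

lemmas oct_ops = zero_oct_def one_oct_def plus_oct_def uminus_oct_def minus_oct_def
  scaleR_oct_def times_oct_def hconj_oct_def hre_oct_def

lemma quat_mult_assoc: "(a * b) * c = a * (b * c)" for a b c :: quat
  by (simp add: quat_ops algebra_simps)

lemma quat_mult_hconj: "a * hconj a = ((q0 a)\<^sup>2 + (q1 a)\<^sup>2 + (q2 a)\<^sup>2 + (q3 a)\<^sup>2) *\<^sub>R 1"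
  by (simp add: quat_ops algebra_simps power2_eq_square)

lemma oct_alternative:
  fixes a b :: oct
  shows "a * (a * b) = (a * a) * b" and "(b * a) * a = b * (a * a)"
  apply (simp_all add: oct_ops quat_ops)
  apply (simp_all add: algebra_simps)
  done


section \<open>Hilbert spaces over the quaternions and the octonions\<close>

text \<open>The parameters \<open>lmul\<close>, \<open>rmul\<close> are the left and right multiplication by scalars, \<open>ip\<close> is the
  scalar-valued inner product, and \<open>X p\<close> is the real component $X_p$ of the decomposition
  $X = X_0 \oplus X_1 i_1 \oplus \dots \oplus X_m i_m$.  Real scalars act through the real vector
  space structure of the type; completeness is the class \<open>banach\<close> together with \<open>norm_ip\<close>.\<close>

locale hypercomplex_hilbert_space =
  fixes lmul :: "'k::hypercomplex \<Rightarrow> 'x::banach \<Rightarrow> 'x"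
    and rmul :: "'x \<Rightarrow> 'k \<Rightarrow> 'x"
    and ip :: "'x \<Rightarrow> 'x \<Rightarrow> 'k"
    and X :: "nat \<Rightarrow> 'x set"
  assumes lmul_add_left: "lmul (a + b) x = lmul a x + lmul b x"
    and lmul_add_right: "lmul a (x + y) = lmul a x + lmul a y"
    and rmul_add_left: "rmul (x + y) a = rmul x a + rmul y a"
    and rmul_add_right: "rmul x (a + b) = rmul x a + rmul x b"
    and lmul_real: "lmul (r *\<^sub>R 1) x = r *\<^sub>R x"
    and rmul_real: "rmul x (r *\<^sub>R 1) = r *\<^sub>R x"
    and comp_subspace: "p < length (gens :: 'k list) \<Longrightarrow> subspace (X p)"
    and comp_isomorphic: "\<lbrakk>p < length (gens :: 'k list); q < length (gens :: 'k list)\<rbrakk>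
      \<Longrightarrow> \<exists>f. linear f \<and> bij_betw f (X p) (X q)"
    and comp_commute: "\<lbrakk>p < length (gens :: 'k list); x \<in> X p\<rbrakk> \<Longrightarrow> lmul a x = rmul x a"
    and comp_direct_sum: "\<exists>!c. c \<in> (\<Pi>\<^sub>E p\<in>{..<length (gens :: 'k list)}. X p) \<and>
      x = (\<Sum>p<length (gens :: 'k list). rmul (c p) (gens ! p))"
    and ip_add_left: "ip (x + y) z = ip x z + ip y z"
    and ip_add_right: "ip x (y + z) = ip x y + ip x z"
    and ip_scaleR_left: "ip (r *\<^sub>R x) y = r *\<^sub>R ip x y"
    and ip_scaleR_right: "ip x (r *\<^sub>R y) = r *\<^sub>R ip x y"
    and ip_nonneg: "\<exists>r\<ge>0. ip x x = r *\<^sub>R 1"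
    and ip_definite: "ip x x = 0 \<Longrightarrow> x = 0"
    and ip_hconj: "ip x y = hconj (ip y x)"
    and ip_comp_real: "\<lbrakk>p < length (gens :: 'k list); q < length (gens :: 'k list);
      x \<in> X p; y \<in> X q\<rbrakk> \<Longrightarrow> \<exists>r. ip x y = r *\<^sub>R 1"
    and ip_comp_gens: "\<lbrakk>p < length (gens :: 'k list); q < length (gens :: 'k list);
      x \<in> X p; y \<in> X q\<rbrakk>
      \<Longrightarrow> ip (rmul x (gens ! p)) (rmul y (gens ! q)) = ip x y * (hconj (gens ! p) * gens ! q)"
    and norm_ip: "norm x = sqrt (hre (ip x x))"

locale quaternion_hilbert_space = hypercomplex_hilbert_space lmul rmul ip X
  for lmul :: "quat \<Rightarrow> 'x::banach \<Rightarrow> 'x" and rmul ip X +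
  assumes lmul_assoc: "lmul a (lmul b x) = lmul (a * b) x"
    and rmul_assoc: "rmul (rmul x b) a = rmul x (b * a)"
    and ip_rmul: "ip (rmul x a) (rmul y b) = hconj a * ip x y * b"

locale octonion_hilbert_space = hypercomplex_hilbert_space lmul rmul ip X
  for lmul :: "oct \<Rightarrow> 'x::banach \<Rightarrow> 'x" and rmul ip X +
  assumes lmul_alternative: "lmul b (lmul b x) = lmul (b * b) x"
    and rmul_alternative: "rmul (rmul x b) b = rmul x (b * b)"
    and ip_rmul_left: "ip (rmul x a) x = hconj a * ip x x"


section \<open>Operator algebras\<close>

text \<open>Bounded additive $\mathbf R$-homogeneous maps are the bounded real-linear maps, that is,
  $L_q(X)$ is the type of bounded linear functions, with its operator norm.

  The equation $\langle Tx,y\rangle = \langle x,T^*y\rangle$ can be read in the scalar algebra or in its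
  real part.  Only the second reading gives an involution defined on all of $L_q(X)$: by
  \<open>no_K_adjoint_of_right_scalars\<close> below, over the quaternions a nonzero \<open>T\<close> and its right multiples
  \<open>T b\<close> cannot all have adjoints in the first sense.  Both relations are considered; \<open>K_adjoint\<close> implies \<open>re_adjoint\<close>, and
  adjoints are unique for both.\<close>

definition K_adjoint ::
  "('x \<Rightarrow> 'x \<Rightarrow> 'k::hypercomplex) \<Rightarrow> ('x::banach \<Rightarrow>\<^sub>L 'x) \<Rightarrow> ('x \<Rightarrow>\<^sub>L 'x) \<Rightarrow> bool" where
  "K_adjoint ip T S \<longleftrightarrow> (\<forall>x y. ip (T x) y = ip x (S y))"

definition re_adjoint ::
  "('x \<Rightarrow> 'x \<Rightarrow> 'k::hypercomplex) \<Rightarrow> ('x::banach \<Rightarrow>\<^sub>L 'x) \<Rightarrow> ('x \<Rightarrow>\<^sub>L 'x) \<Rightarrow> bool" where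
  "re_adjoint ip T S \<longleftrightarrow> (\<forall>x y. hre (ip (T x) y) = hre (ip x (S y)))"

text \<open>A selfadjoint $C^*$-algebra over the scalars, with involution \<open>adj\<close>, contained in $L_q(X)$.
  The algebraic laws, the $C^*$-identity and the submultiplicativity of the norm are inherited
  from $L_q(X)$, and completeness is norm-closedness.  The unit need not be the identity operator.
  The scalar multiples $(bT)(x) = b(T(x))$ and $(Tb)(x) = (T(x))b$ are required to
  lie in \<open>C\<close> whenever they are bounded and have an adjoint; for \<open>re_adjoint\<close> every bounded operator
  has one, while for \<open>K_adjoint\<close>, over the quaternions, an unconditional requirement would only
  admit the algebra consisting of $0$.
  The law $(\alpha T)^* = T^*\tilde\alpha$ is not imposed: the adjoint of $\alpha T$ is
  $x \mapsto T^*(\tilde\alpha x)$, whenever left multiplication by $\tilde\alpha$ is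
  adjoint to left multiplication by $\alpha$.\<close>

definition operator_cstar_algebra ::
  "('k::hypercomplex \<Rightarrow> 'x::banach \<Rightarrow> 'x) \<Rightarrow> ('x \<Rightarrow> 'k \<Rightarrow> 'x)
    \<Rightarrow> (('x \<Rightarrow>\<^sub>L 'x) \<Rightarrow> ('x \<Rightarrow>\<^sub>L 'x) \<Rightarrow> bool) \<Rightarrow> ('x \<Rightarrow>\<^sub>L 'x) set \<Rightarrow> bool" where
  "operator_cstar_algebra lmul rmul adj C \<longleftrightarrow>
     subspace C \<and> closed C \<and>
     (\<forall>S\<in>C. \<forall>T\<in>C. S o\<^sub>L T \<in> C) \<and>
     (\<exists>E\<in>C. \<forall>T\<in>C. E o\<^sub>L T = T \<and> T o\<^sub>L E = T) \<and>
     (\<forall>T\<in>C. \<exists>S\<in>C. adj T S) \<and>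
     (\<forall>T\<in>C. \<forall>b S. (\<forall>x. blinfun_apply S x = lmul b (blinfun_apply T x)) \<and> (\<exists>S'. adj S S') \<longrightarrow> S \<in> C) \<and>
     (\<forall>T\<in>C. \<forall>b S. (\<forall>x. blinfun_apply S x = rmul (blinfun_apply T x) b) \<and> (\<exists>S'. adj S S') \<longrightarrow> S \<in> C)"

abbreviation cl_s :: "('x::banach \<Rightarrow>\<^sub>L 'x) set \<Rightarrow> ('x \<Rightarrow>\<^sub>L 'x) set" where
  "cl_s Y \<equiv> strong_operator_topology closure_of Y"

definition unit_ball :: "('x::banach \<Rightarrow>\<^sub>L 'x) set \<Rightarrow> ('x \<Rightarrow>\<^sub>L 'x) set" where
  "unit_ball Y = {T \<in> Y. norm T \<le> 1}"

lemma K_adjoint_imp_re_adjoint: "K_adjoint ip T S \<Longrightarrow> re_adjoint ip T S"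
  by (simp add: K_adjoint_def re_adjoint_def)

lemma (in quaternion_hilbert_space) no_K_adjoint_of_right_scalars:
  assumes T: "\<And>x y. ip (T x) y = ip x (S y)"
    and Tb: "\<And>x y. ip (rmul (T x) (Quat 0 0 1 0)) y = ip x (R y)"
  shows "T x = 0"
proof -
  have one: "rmul y 1 = y" for y
    using rmul_real[of y 1] by simp
  have mult_one: "a * 1 = a" for a :: quat
    by (simp add: quat_ops)
  have left: "ip (rmul y a) z = hconj a * ip y z" for y z a
    using ip_rmul[of y a z 1] by (simp add: one mult_one)
  let ?i = "Quat 0 1 0 0" and ?j = "Quat 0 0 1 0"
  have "hconj ?j * (hconj ?i * ip (T x) y) = hconj ?i * (hconj ?j * ip (T x) y)" for y
    by (metis T Tb left)
  then have "hconj ?j * (hconj ?i * ip (T x) (T x)) = hconj ?i * (hconj ?j * ip (T x) (T x))" .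
  moreover obtain r where "ip (T x) (T x) = r *\<^sub>R 1"
    using ip_nonneg by blast
  ultimately have "ip (T x) (T x) = 0"
    by (simp add: quat_ops)
  then show ?thesis
    by (rule ip_definite)
qed

end

theory Submission
  imports Defs
begin

text \<open>
  Everything takes place in the real Hilbert space obtained from \<open>X\<close> by taking the real part of the
  inner product; there \<open>C\<close> is a norm-closed real \<open>*\<close>-algebra, and the statement is Kaplansky's density
  theorem for it.

  The proof rests on the transform \<open>f(A) = 2A(1 + A\<^sup>\<dagger>A)\<^sup>-\<^sup>1\<close>, which maps every operator into the unit
  ball (\<open>kaplansky_pair_norm_le\<close>), maps \<open>C\<close> into \<open>C\<close> (\<open>ex_kaplansky_pair_in_C\<close>), respects adjoints
  (\<open>kaplansky_pair_radjoint\<close>), and is continuous at every operator \<open>S\<close>: in order that \<open>f(A)x\<close> be close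
  to \<open>f(S)x\<close> it suffices that \<open>A\<close> be close to \<open>S\<close> at one vector and \<open>A\<^sup>\<dagger>\<close> close to \<open>S\<^sup>\<dagger>\<close> at another
  (\<open>kaplansky_pair_dist_le\<close>).  An operator \<open>T\<close> of norm less than one in the closure of \<open>C\<close> is \<open>f(S)\<close>
  for a unique small \<open>S\<close> in the closure (\<open>ex1_kaplansky_preimage\<close>).  Approximating \<open>S\<close> by
  elements \<open>A\<close> of \<open>C\<close> without regard to their norms, one obtains approximants \<open>f(A)\<close> of \<open>T\<close> in the unit ball
  of \<open>C\<close>; when \<open>T\<close> is selfadjoint, so is \<open>S\<close>, and \<open>A\<close> can be replaced by \<open>(A + A\<^sup>\<dagger>)/2\<close>.

  The continuity statement requires adjoints to be approximated as well.  This costs nothing: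
  a subspace of operators has the same strong and strong-* closures
  (\<open>cl_s_subset_strong_star_closure\<close>), because \<open>A \<mapsto> z \<odot> A\<^sup>\<dagger>v = Az \<odot> v\<close> is strongly continuous.
  Since \<open>f\<close> is applied to arbitrary, not only selfadjoint, operators, the
  customary passage to \<open>2 \<times> 2\<close> matrices is avoided.  Inverses and preimages come from
  Banach's fixed-point theorem, which takes the place of a functional calculus.
\<close>

section \<open>Real Hilbert spaces and approximation by subspaces\<close>

lemma nonneg_quadratic_linear_coeff_zero:
  fixes l q :: real
  assumes quad: "\<And>t. 0 \<le> 2 * t * l + t\<^sup>2 * q" and q: "q \<ge> 0"
  shows "l = 0"
proof -
  define s where "s = 1 / (q + 1)"
  have s: "s > 0" "s * q \<le> 1" using q by (auto simp: s_def field_simps)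
  have "0 \<le> 2 * (- l * s) * l + (- l * s)\<^sup>2 * q" by (rule quad)
  also have "\<dots> = l\<^sup>2 * s * (s * q - 2)" by (simp add: power2_eq_square algebra_simps)
  also have "\<dots> \<le> l\<^sup>2 * s * (- 1)" using s by (intro mult_left_mono) auto
  finally show ?thesis using s by (simp add: mult_le_0_iff)
qed

text \<open>The type class of real inner product spaces does not fit here: the inner product is the real part
  of one that is a parameter of the ambient Hilbert space, so it has to be a parameter as well.\<close>

locale real_hilbert_space =
  fixes rip :: "'x::banach \<Rightarrow> 'x \<Rightarrow> real"  (infixl "\<odot>" 70)
  assumes rip_add_left: "(x + y) \<odot> z = x \<odot> z + y \<odot> z"
    and rip_scaleR_left: "(r *\<^sub>R x) \<odot> y = r * (x \<odot> y)"
    and rip_commute: "x \<odot> y = y \<odot> x"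
    and rip_self: "x \<odot> x = (norm x)\<^sup>2"
begin

lemma rip_add_right: "x \<odot> (y + z) = x \<odot> y + x \<odot> z"
  by (metis rip_add_left rip_commute)

lemma rip_scaleR_right: "x \<odot> (r *\<^sub>R y) = r * (x \<odot> y)"
  by (metis rip_scaleR_left rip_commute)

lemma rip_minus_left: "(- x) \<odot> y = - (x \<odot> y)"
  using rip_scaleR_left[of "-1" x y] by simp

lemma rip_minus_right: "x \<odot> (- y) = - (x \<odot> y)"
  using rip_scaleR_right[of x "-1" y] by simp

lemma rip_diff_left: "(x - y) \<odot> z = x \<odot> z - y \<odot> z"
  using rip_add_left[of x "- y" z] by (simp add: rip_minus_left)

lemma rip_diff_right: "x \<odot> (y - z) = x \<odot> y - x \<odot> z"
  using rip_add_right[of x y "- z"] by (simp add: rip_minus_right)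

lemmas rip_simps = rip_add_left rip_add_right rip_scaleR_left rip_scaleR_right
  rip_minus_left rip_minus_right rip_diff_left rip_diff_right

lemma rip_zero [simp]: "0 \<odot> x = 0" "x \<odot> 0 = 0"
  using rip_scaleR_left[of 0 0 x] rip_scaleR_right[of x 0 0] by auto

lemma norm_add_sq: "(norm (x + y))\<^sup>2 = (norm x)\<^sup>2 + 2 * (x \<odot> y) + (norm y)\<^sup>2"
  by (simp add: rip_commute[of y x] rip_simps flip: rip_self)

lemma norm_diff_sq: "(norm (x - y))\<^sup>2 = (norm x)\<^sup>2 - 2 * (x \<odot> y) + (norm y)\<^sup>2"
  using norm_add_sq[of x "- y"] by (simp add: rip_simps)

lemma rip_le_norm: "x \<odot> y \<le> norm x * norm y"
proof (cases "x = 0 \<or> y = 0")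
  case False
  let ?u = "norm y *\<^sub>R x - norm x *\<^sub>R y"
  have "0 \<le> (norm ?u)\<^sup>2" by simp
  also have "\<dots> = 2 * (norm x * norm y) * (norm x * norm y - x \<odot> y)"
    unfolding norm_diff_sq by (simp add: rip_simps algebra_simps power2_eq_square)
  finally have "0 \<le> (norm x * norm y) * (norm x * norm y - x \<odot> y)" by simp
  then have "0 \<le> norm x * norm y - x \<odot> y"
    using False by (auto simp: zero_le_mult_iff mult_le_0_iff)
  then show ?thesis by simp
qed auto

lemma abs_rip_le_norm: "\<bar>x \<odot> y\<bar> \<le> norm x * norm y"
  using rip_le_norm[of x y] rip_le_norm[of "- x" y] by (simp add: rip_simps)

lemma bounded_linear_rip: "bounded_linear ((\<odot>) x)"
  by (rule bounded_linear_intro[where K = "norm x"])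
    (use abs_rip_le_norm[of x] in \<open>auto simp: rip_simps mult.commute[of _ "norm x"]\<close>)

lemmas tendsto_rip = bounded_linear.tendsto[OF bounded_linear_rip]

lemma rip_eqI: "(\<And>z. z \<odot> x = z \<odot> y) \<Longrightarrow> x = y"
  using rip_self[of "x - y"] by (simp add: rip_simps)

text \<open>Orthogonal projection in a finite power \<open>X\<^sup>I\<close>, phrased for the subspace
  \<open>{(L i a)\<^sub>i | a \<in> C}\<close> so that no type for the power is needed: a minimizing sequence for the distance
  to \<open>w\<close> is Cauchy by the parallelogram law, and its limit minus \<open>w\<close> is orthogonal to the
  subspace.  If such a vector is orthogonal to \<open>w\<close> as well, then it is zero.  This replaces the
  Hahn--Banach theorem in the comparison of weak and strong closures, and it also yields
  the Riesz representation.\<close>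

lemma dense_if_orthogonal_vanish:
  fixes L :: "'i \<Rightarrow> 'b::real_vector \<Rightarrow> 'x"
  assumes I: "finite I" and C: "subspace C" and L: "\<And>i. i \<in> I \<Longrightarrow> linear (L i)"
    and orth: "\<And>y. (\<And>a. a \<in> C \<Longrightarrow> (\<Sum>i\<in>I. y i \<odot> L i a) = 0) \<Longrightarrow> (\<Sum>i\<in>I. y i \<odot> w i) = 0"
    and e: "e > 0"
  shows "\<exists>a\<in>C. \<forall>i\<in>I. norm (L i a - w i) < e"
proof -
  define \<Phi> where "\<Phi> a = (\<Sum>i\<in>I. (norm (L i a - w i))\<^sup>2)" for a
  define \<delta> where "\<delta> = Inf (\<Phi> ` C)"
  have C0: "C \<noteq> {}" using subspace_0[OF C] by blast
  have bdd: "bdd_below (\<Phi> ` C)"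
    by (rule bdd_belowI[of _ 0]) (auto simp: \<Phi>_def intro: sum_nonneg)
  have \<delta>: "\<delta> \<le> \<Phi> a" if "a \<in> C" for a
    unfolding \<delta>_def by (rule cInf_lower) (use that bdd in auto)
  have "\<exists>a\<in>C. \<Phi> a < \<delta> + inverse (Suc k)" for k
    using cInf_lessD[of "\<Phi> ` C" "\<delta> + inverse (Suc k)"] C0 unfolding \<delta>_def by auto
  then obtain a where aC: "a k \<in> C" and a: "\<Phi> (a k) < \<delta> + inverse (Suc k)" for k
    by metis
  have "(\<lambda>k. \<delta> + inverse (Suc k)) \<longlonglongrightarrow> \<delta> + 0"
    by (rule tendsto_add[OF tendsto_const LIMSEQ_inverse_real_of_nat])
  then have up: "(\<lambda>k. \<delta> + inverse (Suc k)) \<longlonglongrightarrow> \<delta>" by simp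
  have \<Phi>a: "(\<lambda>k. \<Phi> (a k)) \<longlonglongrightarrow> \<delta>"
  proof (rule tendsto_sandwich[OF _ _ tendsto_const up])
    show "\<forall>\<^sub>F k in sequentially. \<delta> \<le> \<Phi> (a k)" using \<delta>[OF aC] by simp
    show "\<forall>\<^sub>F k in sequentially. \<Phi> (a k) \<le> \<delta> + inverse (Suc k)"
      using a less_imp_le by (intro always_eventually allI) blast
  qed
  have close: "(\<Sum>i\<in>I. (norm (L i (a m) - L i (a n)))\<^sup>2) \<le> 2 * inverse (Suc m) + 2 * inverse (Suc n)" for m n
  proof -
    let ?b = "(1/2) *\<^sub>R (a m + a n)"
    have "?b \<in> C" using C aC by (simp add: subspace_add subspace_scale)
    note \<delta>[OF this]
    moreover have "(\<Sum>i\<in>I. (norm (L i (a m) - L i (a n)))\<^sup>2) = 2 * \<Phi> (a m) + 2 * \<Phi> (a n) - 4 * \<Phi> ?b"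
      unfolding \<Phi>_def sum_distrib_left sum.distrib[symmetric] sum_subtractf[symmetric]
    proof (rule sum.cong[OF refl])
      fix i assume "i \<in> I"
      then have "L i ?b = (1/2) *\<^sub>R (L i (a m) + L i (a n))"
        using L by (simp add: linear_scale linear_add)
      then have *: "2 *\<^sub>R (L i ?b - w i) = (L i (a m) - w i) + (L i (a n) - w i)"
        by (simp add: algebra_simps scaleR_2)
      have "4 * (norm (L i ?b - w i))\<^sup>2 = (norm (2 *\<^sub>R (L i ?b - w i)))\<^sup>2"
        by (simp add: power_mult_distrib)
      also have "\<dots> = (norm (L i (a m) - w i))\<^sup>2 + 2 * ((L i (a m) - w i) \<odot> (L i (a n) - w i))
          + (norm (L i (a n) - w i))\<^sup>2"
        unfolding * norm_add_sq ..
      finally show "(norm (L i (a m) - L i (a n)))\<^sup>2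
          = 2 * (norm (L i (a m) - w i))\<^sup>2 + 2 * (norm (L i (a n) - w i))\<^sup>2 - 4 * (norm (L i ?b - w i))\<^sup>2"
        using norm_diff_sq[of "L i (a m) - w i" "L i (a n) - w i"] by simp
    qed
    ultimately show ?thesis using a[of m] a[of n] by linarith
  qed
  have "\<exists>p. (\<lambda>k. L i (a k)) \<longlonglongrightarrow> p" if i: "i \<in> I" for i
  proof -
    have "Cauchy (\<lambda>k. L i (a k))"
    proof (rule metric_CauchyI)
      fix e :: real assume e: "e > 0"
      obtain M where M: "inverse (real (Suc M)) < e\<^sup>2 / 4"
        using reals_Archimedean[of "e\<^sup>2 / 4"] e by auto
      have "dist (L i (a m)) (L i (a n)) < e" if "m \<ge> M" "n \<ge> M" for m n
      proof -
        have "(norm (L i (a m) - L i (a n)))\<^sup>2 \<le> (\<Sum>i\<in>I. (norm (L i (a m) - L i (a n)))\<^sup>2)"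
          by (rule member_le_sum[OF i _ I]) auto
        moreover have "inverse (Suc m) \<le> inverse (real (Suc M))" "inverse (Suc n) \<le> inverse (real (Suc M))"
          using that by (auto intro!: le_imp_inverse_le)
        ultimately have "(norm (L i (a m) - L i (a n)))\<^sup>2 < e\<^sup>2"
          using close[of m n] M by linarith
        then show ?thesis using e by (simp add: dist_norm power_less_imp_less_base)
      qed
      then show "\<exists>M. \<forall>m\<ge>M. \<forall>n\<ge>M. dist (L i (a m)) (L i (a n)) < e" by blast
    qed
    then show ?thesis using Cauchy_convergent convergent_def by blast
  qed
  then obtain p where p: "\<And>i. i \<in> I \<Longrightarrow> (\<lambda>k. L i (a k)) \<longlonglongrightarrow> p i" by metis
  define y where "y i = p i - w i" for i
  have "(\<lambda>k. \<Phi> (a k)) \<longlonglongrightarrow> (\<Sum>i\<in>I. (norm (y i))\<^sup>2)"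
    unfolding \<Phi>_def y_def by (intro tendsto_intros p)
  then have y\<delta>: "(\<Sum>i\<in>I. (norm (y i))\<^sup>2) = \<delta>" using \<Phi>a LIMSEQ_unique by blast
  have y0: "(\<Sum>i\<in>I. y i \<odot> L i b) = 0" if b: "b \<in> C" for b
  proof -
    let ?l = "\<Sum>i\<in>I. y i \<odot> L i b" and ?q = "\<Sum>i\<in>I. (norm (L i b))\<^sup>2"
    \<comment> \<open>Moving from the limit point along \<open>b\<close> cannot decrease the distance to \<open>w\<close>.\<close>
    have quad: "0 \<le> 2 * t * ?l + t\<^sup>2 * ?q" for t
    proof -
      have "(\<lambda>k. \<Phi> (a k + t *\<^sub>R b)) = (\<lambda>k. \<Sum>i\<in>I. (norm (L i (a k) - w i + t *\<^sub>R L i b))\<^sup>2)"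
        unfolding \<Phi>_def using L
        by (intro ext sum.cong refl) (simp add: linear_add linear_scale algebra_simps)
      also have "\<dots> \<longlonglongrightarrow> (\<Sum>i\<in>I. (norm (y i + t *\<^sub>R L i b))\<^sup>2)"
        unfolding y_def by (intro tendsto_intros p)
      finally have lim: "(\<lambda>k. \<Phi> (a k + t *\<^sub>R b)) \<longlonglongrightarrow> (\<Sum>i\<in>I. (norm (y i + t *\<^sub>R L i b))\<^sup>2)" .
      have "\<delta> \<le> \<Phi> (a k + t *\<^sub>R b)" for k
        using C aC b by (intro \<delta>) (simp add: subspace_add subspace_scale)
      then have "\<delta> \<le> (\<Sum>i\<in>I. (norm (y i + t *\<^sub>R L i b))\<^sup>2)"
        by (intro LIMSEQ_le_const[OF lim]) blast
      also have "\<dots> = \<delta> + 2 * t * ?l + t\<^sup>2 * ?q"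
        unfolding y\<delta>[symmetric] sum_distrib_left sum.distrib[symmetric]
        by (intro sum.cong refl) (simp add: norm_add_sq rip_simps power_mult_distrib)
      finally show ?thesis by simp
    qed
    have q: "?q \<ge> 0" by (simp add: sum_nonneg)
    show ?thesis by (rule nonneg_quadratic_linear_coeff_zero[OF quad q])
  qed
  have "(\<lambda>k. \<Sum>i\<in>I. y i \<odot> L i (a k)) \<longlonglongrightarrow> (\<Sum>i\<in>I. y i \<odot> p i)"
    by (intro tendsto_sum tendsto_rip p)
  then have "(\<Sum>i\<in>I. y i \<odot> p i) = 0"
    using y0[OF aC] LIMSEQ_unique[OF _ tendsto_const[of 0]] by simp
  moreover have "(\<Sum>i\<in>I. y i \<odot> w i) = 0" using orth y0 by blast
  moreover have "(\<Sum>i\<in>I. (norm (y i))\<^sup>2) = (\<Sum>i\<in>I. y i \<odot> p i) - (\<Sum>i\<in>I. y i \<odot> w i)"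
    unfolding sum_subtractf[symmetric] by (simp add: y_def rip_simps flip: rip_self)
  ultimately have "\<delta> = 0" using y\<delta> by simp
  then obtain k where k: "\<Phi> (a k) < e\<^sup>2"
    using order_tendstoD(2)[OF \<Phi>a, of "e\<^sup>2"] e eventually_sequentially by auto
  have "norm (L i (a k) - w i) < e" if i: "i \<in> I" for i
  proof -
    have "(norm (L i (a k) - w i))\<^sup>2 \<le> \<Phi> (a k)"
      unfolding \<Phi>_def by (rule member_le_sum[OF i _ I]) auto
    then show ?thesis using k e by (meson le_less_trans less_imp_le power_less_imp_less_base)
  qed
  then show ?thesis using aC by blast
qed

text \<open>A vector \<open>w\<close> with \<open>\<phi> w = 1\<close> keeps a positive distance from the kernel, so
  some \<open>y\<close> is orthogonal to the kernel but not to \<open>w\<close>; a multiple of \<open>y\<close> represents \<open>\<phi>\<close>.\<close>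

lemma riesz_representation:
  assumes \<phi>: "bounded_linear \<phi>"
  shows "\<exists>y. \<forall>x. \<phi> x = y \<odot> x"
proof (cases "\<forall>x. \<phi> x = 0")
  case True
  then show ?thesis by (intro exI[of _ 0]) simp
next
  case False
  interpret \<phi>: bounded_linear \<phi> by fact
  obtain u where u: "\<phi> u \<noteq> 0" using False by blast
  define w where "w = (1 / \<phi> u) *\<^sub>R u"
  have w: "\<phi> w = 1" using u by (simp add: w_def \<phi>.scaleR)
  obtain K where K: "K > 0" "\<And>x. norm (\<phi> x) \<le> norm x * K" using \<phi>.pos_bounded by blast
  have far: "\<not> (\<exists>a\<in>{x. \<phi> x = 0}. \<forall>i\<in>{()}. norm (a - w) < 1 / K)"
  proof safe
    fix a assume "\<phi> a = 0" and 0: "\<forall>i\<in>{()}. norm (a - w) < 1 / K"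
    then have "1 \<le> norm (a - w) * K" using K(2)[of "a - w"] w by (simp add: \<phi>.diff)
    then show False using 0 K(1) by (simp add: field_simps)
  qed
  have "subspace {x. \<phi> x = 0}"
    by (auto intro!: subspaceI simp: \<phi>.add \<phi>.scaleR \<phi>.zero)
  then obtain y where y: "\<And>a. \<phi> a = 0 \<Longrightarrow> y () \<odot> a = 0" and yw: "y () \<odot> w \<noteq> 0"
    using dense_if_orthogonal_vanish[of "{()}" "{x. \<phi> x = 0}" "\<lambda>_ x. x" "\<lambda>_. w" "1 / K"] K(1) far
    by (auto simp: linear_id[unfolded id_def])
  have "\<phi> x = ((1 / (y () \<odot> w)) *\<^sub>R y ()) \<odot> x" for x
  proof -
    have "y () \<odot> (x - \<phi> x *\<^sub>R w) = 0" by (rule y) (simp add: \<phi>.diff \<phi>.scaleR w)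
    then show ?thesis using yw by (simp add: rip_diff_right rip_scaleR_left rip_scaleR_right)
  qed
  then show ?thesis by (intro exI allI)
qed

section \<open>Adjoints\<close>

lemma adjoint_exists: "\<exists>S :: 'x \<Rightarrow>\<^sub>L 'x. \<forall>x y. blinfun_apply T x \<odot> y = x \<odot> S y"
  for T :: "'x \<Rightarrow>\<^sub>L 'x"
proof -
  have "\<exists>z. \<forall>x. y \<odot> T x = z \<odot> x" for y
    by (rule riesz_representation)
      (rule bounded_linear_compose[OF bounded_linear_rip blinfun.bounded_linear_right])
  then obtain S where S: "\<And>x y. y \<odot> T x = S y \<odot> x" by metis
  have adj: "T x \<odot> y = x \<odot> S y" for x y
    using S[of y x] by (simp add: rip_commute)
  have "bounded_linear S"
  proof (rule bounded_linear_intro[where K = "norm T"])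
    show "S (x + y) = S x + S y" for x y
      by (rule rip_eqI) (simp add: rip_add_right rip_scaleR_right flip: adj)
    show "S (r *\<^sub>R x) = r *\<^sub>R S x" for r x
      by (rule rip_eqI) (simp add: rip_add_right rip_scaleR_right flip: adj)
    show "norm (S x) \<le> norm x * norm T" for x
    proof -
      have "norm (S x) * norm (S x) = x \<odot> T (S x)" by (simp add: S rip_self power2_eq_square)
      also have "\<dots> \<le> norm x * norm (T (S x))" by (rule rip_le_norm)
      also have "\<dots> \<le> norm x * norm T * norm (S x)"
        using norm_blinfun[of T "S x"] by (simp add: mult_left_mono mult.assoc)
      finally show ?thesis
        by (cases "S x = 0") (auto simp: mult_le_cancel_right)
    qed
  qed
  then show ?thesis
    by (intro exI[of _ "Blinfun S"]) (simp add: bounded_linear_Blinfun_apply adj)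
qed

definition radjoint :: "('x \<Rightarrow>\<^sub>L 'x) \<Rightarrow> ('x \<Rightarrow>\<^sub>L 'x)"  ("_\<^sup>\<dagger>" [1000] 1000)
  where "T\<^sup>\<dagger> = (SOME S. \<forall>x y. blinfun_apply T x \<odot> y = x \<odot> blinfun_apply S y)"

lemma rip_radjoint: "blinfun_apply T x \<odot> y = x \<odot> (T\<^sup>\<dagger>) y"
  unfolding radjoint_def using someI_ex[OF adjoint_exists[of T]] by blast

lemma rip_radjoint': "(T\<^sup>\<dagger>) x \<odot> y = x \<odot> T y"
  by (metis rip_radjoint rip_commute)

lemma radjoint_eqI: "(\<And>x y. blinfun_apply T x \<odot> y = x \<odot> blinfun_apply S y) \<Longrightarrow> T\<^sup>\<dagger> = S"
  by (rule blinfun_eqI, rule rip_eqI) (simp flip: rip_radjoint)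

lemma radjoint_radjoint [simp]: "T\<^sup>\<dagger>\<^sup>\<dagger> = T"
  by (rule radjoint_eqI) (rule rip_radjoint')

lemma radjoint_add: "(S + T)\<^sup>\<dagger> = S\<^sup>\<dagger> + T\<^sup>\<dagger>"
  by (rule radjoint_eqI) (simp add: blinfun.bilinear_simps rip_simps rip_radjoint)

lemma radjoint_scaleR: "(r *\<^sub>R T)\<^sup>\<dagger> = r *\<^sub>R T\<^sup>\<dagger>"
  by (rule radjoint_eqI) (simp add: blinfun.bilinear_simps rip_simps rip_radjoint)

lemma radjoint_diff: "(S - T)\<^sup>\<dagger> = S\<^sup>\<dagger> - T\<^sup>\<dagger>"
  by (rule radjoint_eqI) (simp add: blinfun.bilinear_simps rip_simps rip_radjoint)

lemma radjoint_compose: "(S o\<^sub>L T)\<^sup>\<dagger> = T\<^sup>\<dagger> o\<^sub>L S\<^sup>\<dagger>"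
  by (rule radjoint_eqI) (simp add: rip_radjoint)

lemma norm_radjoint_le: "norm (T\<^sup>\<dagger>) \<le> norm T"
proof (rule norm_blinfun_bound)
  fix x
  have "norm ((T\<^sup>\<dagger>) x) * norm ((T\<^sup>\<dagger>) x) = x \<odot> T ((T\<^sup>\<dagger>) x)"
    by (simp add: rip_self power2_eq_square flip: rip_radjoint')
  also have "\<dots> \<le> norm x * norm (T ((T\<^sup>\<dagger>) x))" by (rule rip_le_norm)
  also have "\<dots> \<le> norm T * norm x * norm ((T\<^sup>\<dagger>) x)"
    using norm_blinfun[of T "(T\<^sup>\<dagger>) x"] by (simp add: mult_left_mono mult_ac)
  finally show "norm ((T\<^sup>\<dagger>) x) \<le> norm T * norm x"
    by (cases "(T\<^sup>\<dagger>) x = 0") (auto simp: mult_le_cancel_right)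
qed simp

lemma norm_radjoint [simp]: "norm (T\<^sup>\<dagger>) = norm T"
  using norm_radjoint_le[of T] norm_radjoint_le[of "T\<^sup>\<dagger>"] by simp

end

section \<open>The strong operator topology\<close>

lemma in_cl_s_iff:
  "T \<in> cl_s Y \<longleftrightarrow> (\<forall>F e. finite F \<longrightarrow> e > 0 \<longrightarrow> (\<exists>A\<in>Y. \<forall>v\<in>F. norm (A v - T v) < e))"
  (is "_ \<longleftrightarrow> ?approx")
  for T :: "'x::banach \<Rightarrow>\<^sub>L 'x"
proof
  assume T: "T \<in> cl_s Y"
  show ?approx
  proof (intro allI impI)
    fix F :: "'x set" and e :: real assume F: "finite F" and e: "e > 0"
    let ?W = "{f. \<forall>v\<in>F. blinfun_apply f v \<in> ball (T v) e}"
    have "openin strong_operator_topology ?W"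
      by (rule strong_operator_topology_basis[OF F]) simp
    moreover have "T \<in> ?W" using e by simp
    ultimately have "\<exists>A. A \<in> Y \<and> A \<in> ?W"
      by (intro T[unfolded in_closure_of, THEN conjunct2, rule_format] conjI)
    then show "\<exists>A\<in>Y. \<forall>v\<in>F. norm (A v - T v) < e"
      by (auto simp: dist_norm norm_minus_commute)
  qed
next
  assume approx: ?approx
  show "T \<in> cl_s Y"
    unfolding in_closure_of strong_operator_topology_topspace
  proof (intro conjI UNIV_I allI impI)
    fix W :: "('x \<Rightarrow>\<^sub>L 'x) set" assume W: "T \<in> W \<and> openin strong_operator_topology W"
    then obtain U where U: "open U" "W = blinfun_apply -` U"
      unfolding strong_operator_topology_def openin_pullback_topology by auto
    have "openin (product_topology (\<lambda>i. euclidean) UNIV) U" "blinfun_apply T \<in> U"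
      using U W by (auto simp: euclidean_product_topology)
    then obtain X where X: "\<And>i. T i \<in> X i" "\<And>i. open (X i)" "finite {i. X i \<noteq> UNIV}"
        "(\<Pi>\<^sub>E i\<in>UNIV. X i) \<subseteq> U"
      using product_topology_open_contains_basis[of "\<lambda>i. euclidean" UNIV U "blinfun_apply T"]
      by (auto simp: PiE_iff)
    have "\<exists>e>0. ball (T i) e \<subseteq> X i" for i
      using X(1,2) open_contains_ball by blast
    then obtain \<epsilon> where \<epsilon>: "\<And>i. \<epsilon> i > 0" "\<And>i. ball (T i) (\<epsilon> i) \<subseteq> X i" by metis
    define e where "e = Min (insert 1 (\<epsilon> ` {i. X i \<noteq> UNIV}))"
    have e0: "e > 0" and e: "\<And>i. X i \<noteq> UNIV \<Longrightarrow> e \<le> \<epsilon> i"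
      unfolding e_def using X(3) \<epsilon>(1) by auto
    then obtain A where A: "A \<in> Y" "\<And>v. X v \<noteq> UNIV \<Longrightarrow> norm (A v - T v) < e"
      using approx[rule_format, OF X(3) e0] by auto
    have "A v \<in> X v" for v
    proof (cases "X v = UNIV")
      case False
      then have "A v \<in> ball (T v) (\<epsilon> v)"
        using A(2)[OF False] e[OF False] by (simp add: dist_norm norm_minus_commute)
      then show ?thesis using \<epsilon>(2) by blast
    qed simp
    then have "A \<in> W" using X(4) U(2) by (auto simp: PiE_iff)
    then show "\<exists>y. y \<in> Y \<and> y \<in> W" using A(1) by blast
  qed
qed

lemma in_cl_sD:
  fixes T :: "'x::banach \<Rightarrow>\<^sub>L 'x"
  assumes "T \<in> cl_s Y" "finite F" "e > 0"
  obtains A where "A \<in> Y" "\<And>v. v \<in> F \<Longrightarrow> norm (blinfun_apply A v - T v) < e"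
proof -
  have "\<exists>A\<in>Y. \<forall>v\<in>F. norm (blinfun_apply A v - T v) < e"
    using assms(1)[unfolded in_cl_s_iff, rule_format, OF assms(2,3)] .
  then show ?thesis by (elim bexE) (rule that, assumption, rule bspec)
qed

context real_hilbert_space
begin

section \<open>The transform $A \mapsto 2A(1 + A^*A)^{-1}$\<close>

lemma rip_self_radjoint: "v \<odot> (A\<^sup>\<dagger>) (A v) = (norm (A v))\<^sup>2"
  by (simp add: rip_self flip: rip_radjoint)

text \<open>Since \<open>0 \<le> A\<^sup>\<dagger>A \<le> \<parallel>A\<parallel>\<^sup>2\<close>, the operator \<open>1 - t (1 + A\<^sup>\<dagger>A)\<close> lies between \<open>0\<close> and \<open>1 - t\<close>.
  Hence equations involving \<open>1 + A\<^sup>\<dagger>A\<close> can be solved by contracting fixed-point iterations, which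
  stay inside any closed subspace that the iteration preserves.\<close>

lemma norm_id_minus_square_le:
  fixes A :: "'x \<Rightarrow>\<^sub>L 'x"
  defines "t \<equiv> 1 / (1 + (norm A)\<^sup>2)"
  shows "norm ((1 - t) *\<^sub>R id_blinfun - t *\<^sub>R (A\<^sup>\<dagger> o\<^sub>L A)) \<le> 1 - t"
proof (rule norm_blinfun_bound)
  have pos: "1 + (norm A)\<^sup>2 > 0" by (simp add: add_pos_nonneg)
  have t: "t > 0" "t \<le> 1" "t * (norm A)\<^sup>2 = 1 - t"
    using pos by (auto simp: t_def field_simps)
  then show "0 \<le> 1 - t" by simp
  fix v
  define P where "P = (A\<^sup>\<dagger>) (A v)"
  have "norm P \<le> norm A * norm (A v)"
    using norm_blinfun[of "A\<^sup>\<dagger>" "A v"] by (simp add: P_def)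
  then have "(norm P)\<^sup>2 \<le> (norm A)\<^sup>2 * (norm (A v))\<^sup>2"
    by (metis norm_ge_zero power_mono power_mult_distrib)
  then have "t\<^sup>2 * (norm P)\<^sup>2 \<le> t\<^sup>2 * ((norm A)\<^sup>2 * (norm (A v))\<^sup>2)"
    by (rule mult_left_mono) simp
  also have "\<dots> = t * (t * (norm A)\<^sup>2) * (norm (A v))\<^sup>2"
    by (simp add: power2_eq_square mult_ac)
  also have "\<dots> = t * (1 - t) * (norm (A v))\<^sup>2" unfolding t(3) ..
  finally have P: "t\<^sup>2 * (norm P)\<^sup>2 \<le> t * (1 - t) * (norm (A v))\<^sup>2" .
  have "(norm ((1 - t) *\<^sub>R v - t *\<^sub>R P))\<^sup>2
      = (1 - t)\<^sup>2 * (norm v)\<^sup>2 - 2 * (t * (1 - t) * (norm (A v))\<^sup>2) + t\<^sup>2 * (norm P)\<^sup>2"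
    unfolding norm_diff_sq
    by (simp add: rip_simps power_mult_distrib P_def rip_self_radjoint mult_ac)
  also have "\<dots> \<le> (1 - t)\<^sup>2 * (norm v)\<^sup>2"
  proof -
    have "0 \<le> t * (1 - t) * (norm (A v))\<^sup>2" using t by simp
    then show ?thesis using P by linarith
  qed
  also have "\<dots> = ((1 - t) * norm v)\<^sup>2" by (simp add: power_mult_distrib)
  finally have "norm ((1 - t) *\<^sub>R v - t *\<^sub>R P) \<le> (1 - t) * norm v"
    by (rule power2_le_imp_le) (use t in simp)
  then show "norm (((1 - t) *\<^sub>R id_blinfun - t *\<^sub>R (A\<^sup>\<dagger> o\<^sub>L A)) v) \<le> (1 - t) * norm v"
    by (simp add: blinfun.bilinear_simps P_def)
qed

lemma one_plus_square_surj:
  fixes A :: "'x \<Rightarrow>\<^sub>L 'x"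
  obtains v where "v + (A\<^sup>\<dagger>) (A v) = w"
proof -
  define t where "t = 1 / (1 + (norm A)\<^sup>2)"
  define Q where "Q = (1 - t) *\<^sub>R id_blinfun - t *\<^sub>R (A\<^sup>\<dagger> o\<^sub>L A)"
  have "1 + (norm A)\<^sup>2 > 0" by (simp add: add_pos_nonneg)
  then have t: "t > 0" "t \<le> 1" by (auto simp: t_def field_simps)
  have Q: "norm Q \<le> 1 - t" unfolding Q_def t_def by (rule norm_id_minus_square_le)
  have "dist (Q x + t *\<^sub>R w) (Q y + t *\<^sub>R w) \<le> (1 - t) * dist x y" for x y
  proof -
    have "dist (Q x + t *\<^sub>R w) (Q y + t *\<^sub>R w) = norm (Q (x - y))"
      by (simp add: dist_norm blinfun.bilinear_simps)
    also have "\<dots> \<le> norm Q * norm (x - y)" by (rule norm_blinfun)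
    also have "\<dots> \<le> (1 - t) * norm (x - y)" using Q by (simp add: mult_right_mono)
    finally show ?thesis by (simp add: dist_norm)
  qed
  then obtain v where "Q v + t *\<^sub>R w = v"
    using banach_fix_type[of "1 - t" "\<lambda>x. Q x + t *\<^sub>R w"] t by auto
  then have "t *\<^sub>R (v + (A\<^sup>\<dagger>) (A v)) = t *\<^sub>R w"
    by (simp add: Q_def blinfun.bilinear_simps algebra_simps)
  then show ?thesis using t by (intro that) simp
qed

text \<open>The relation \<open>B = 2A(1 + A\<^sup>\<dagger>A)\<^sup>-\<^sup>1\<close>, written without an inverse.  For selfadjoint \<open>A\<close> it is
  the function $t \mapsto 2t/(1+t^2)$ of the functional calculus.\<close>

definition kaplansky_pair :: "('x \<Rightarrow>\<^sub>L 'x) \<Rightarrow> ('x \<Rightarrow>\<^sub>L 'x) \<Rightarrow> bool"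
  where "kaplansky_pair A B \<longleftrightarrow> (\<forall>v. B (v + (A\<^sup>\<dagger>) (A v)) = 2 *\<^sub>R A v)"

lemma kaplansky_pairD: "kaplansky_pair A B \<Longrightarrow> B (v + (A\<^sup>\<dagger>) (A v)) = 2 *\<^sub>R A v"
  by (simp add: kaplansky_pair_def)

text \<open>The intertwining relation \<open>A(1 + A\<^sup>\<dagger>A) = (1 + AA\<^sup>\<dagger>)A\<close> moves the inverse to the other side:
  \<open>B = 2(1 + AA\<^sup>\<dagger>)\<^sup>-\<^sup>1A\<close>.  Taking adjoints then shows that the transform commutes with \<open>\<dagger>\<close>.\<close>

lemma kaplansky_pair_left:
  assumes "kaplansky_pair A B"
  shows "B u + A ((A\<^sup>\<dagger>) (B u)) = 2 *\<^sub>R A u"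
proof -
  obtain v where v: "v + (A\<^sup>\<dagger>) (A v) = u" by (rule one_plus_square_surj)
  have "B u = 2 *\<^sub>R A v" using kaplansky_pairD[OF assms, of v] v by simp
  then show ?thesis by (simp add: blinfun.bilinear_simps flip: v scaleR_add_right)
qed

lemma kaplansky_pair_radjoint:
  assumes "kaplansky_pair A B"
  shows "kaplansky_pair (A\<^sup>\<dagger>) (B\<^sup>\<dagger>)"
  unfolding kaplansky_pair_def
proof
  fix v
  have "z \<odot> (B\<^sup>\<dagger>) (v + A ((A\<^sup>\<dagger>) v)) = z \<odot> (2 *\<^sub>R (A\<^sup>\<dagger>) v)" for z
  proof -
    have "z \<odot> (B\<^sup>\<dagger>) (v + A ((A\<^sup>\<dagger>) v)) = (B z + A ((A\<^sup>\<dagger>) (B z))) \<odot> v"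
      unfolding rip_radjoint[of B, symmetric]
      by (simp add: rip_add_left rip_add_right rip_radjoint[of A] rip_radjoint'[of A])
    then show ?thesis
      by (simp add: kaplansky_pair_left[OF assms] rip_simps rip_radjoint)
  qed
  then show "(B\<^sup>\<dagger>) (v + (A\<^sup>\<dagger>\<^sup>\<dagger>) ((A\<^sup>\<dagger>) v)) = 2 *\<^sub>R (A\<^sup>\<dagger>) v"
    by (intro rip_eqI) simp
qed

lemma kaplansky_pair_unique:
  assumes "kaplansky_pair A B" "kaplansky_pair A B'"
  shows "B = B'"
proof (rule blinfun_eqI)
  fix u
  obtain v where v: "v + (A\<^sup>\<dagger>) (A v) = u" by (rule one_plus_square_surj)
  then show "B u = B' u" using assms kaplansky_pairD by metis
qed

text \<open>An operator version of \<open>2t \<le> 1 + t\<^sup>2\<close>: with \<open>P = A\<^sup>\<dagger>Av\<close>, the difference of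
  \<open>\<parallel>v + P\<parallel>\<^sup>2\<close> and \<open>\<parallel>2Av\<parallel>\<^sup>2\<close> is \<open>\<parallel>v - P\<parallel>\<^sup>2\<close>.\<close>

lemma kaplansky_pair_norm_le:
  assumes "kaplansky_pair A B"
  shows "norm B \<le> 1"
proof (rule norm_blinfun_bound)
  fix w
  obtain v where v: "v + (A\<^sup>\<dagger>) (A v) = w" by (rule one_plus_square_surj)
  let ?P = "(A\<^sup>\<dagger>) (A v)"
  have "(norm (2 *\<^sub>R A v))\<^sup>2 = 4 * (v \<odot> ?P)"
    by (simp add: power_mult_distrib rip_self_radjoint)
  also have "\<dots> \<le> (norm (v - ?P))\<^sup>2 + 4 * (v \<odot> ?P)" by simp
  also have "\<dots> = (norm w)\<^sup>2" unfolding v[symmetric] norm_diff_sq norm_add_sq by simp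
  finally have "norm (2 *\<^sub>R A v) \<le> norm w" by (rule power2_le_imp_le) simp
  then show "norm (B w) \<le> 1 * norm w" using kaplansky_pairD[OF assms, of v] v by simp
qed simp

text \<open>The transform is continuous from the strong-* to the strong topology, without any bound on
  the norms of the arguments.  The error \<open>d = Bx - Tx\<close> satisfies
  \<open>(1 + AA\<^sup>\<dagger>)d = 2(A - S)v - 2A(A\<^sup>\<dagger> - S\<^sup>\<dagger>)Sv\<close>; pairing this with \<open>d\<close> controls \<open>\<parallel>d\<parallel>\<^sup>2 + \<parallel>A\<^sup>\<dagger>d\<parallel>\<^sup>2\<close>, and the
  second square absorbs the unbounded factor \<open>A\<close>.\<close>

lemma kaplansky_pair_dist_le:
  assumes AB: "kaplansky_pair A B" and ST: "kaplansky_pair S T"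
    and x: "v + (S\<^sup>\<dagger>) (S v) = x"
  shows "norm (B x - T x) \<le> 2 * norm (A v - S v) + norm ((A\<^sup>\<dagger>) (S v) - (S\<^sup>\<dagger>) (S v))"
proof (rule ccontr)
  define d where "d = B x - T x"
  define a where "a = norm (A v - S v)"
  define b where "b = norm ((A\<^sup>\<dagger>) (S v) - (S\<^sup>\<dagger>) (S v))"
  define q where "q = norm ((A\<^sup>\<dagger>) d)"
  have ab: "a \<ge> 0" "b \<ge> 0" by (auto simp: a_def b_def)
  assume "\<not> ?thesis"
  then have d: "norm d > 2 * a + b" by (simp add: d_def a_def b_def)
  have Tx: "T x = 2 *\<^sub>R S v" using kaplansky_pairD[OF ST, of v] x by simp
  have "d + A ((A\<^sup>\<dagger>) d) = (B x + A ((A\<^sup>\<dagger>) (B x))) - (T x + A ((A\<^sup>\<dagger>) (T x)))"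
    by (simp add: d_def blinfun.bilinear_simps)
  also have "\<dots> = 2 *\<^sub>R A x - (2 *\<^sub>R S v + A ((A\<^sup>\<dagger>) (2 *\<^sub>R S v)))"
    by (simp only: kaplansky_pair_left[OF AB] Tx)
  also have "\<dots> = 2 *\<^sub>R ((A v - S v) - A ((A\<^sup>\<dagger>) (S v) - (S\<^sup>\<dagger>) (S v)))"
    by (simp add: blinfun.bilinear_simps algebra_simps flip: x)
  finally have eq: "d + A ((A\<^sup>\<dagger>) d) = \<dots>" .
  have "(norm d)\<^sup>2 + q\<^sup>2 = d \<odot> (d + A ((A\<^sup>\<dagger>) d))"
    by (simp add: q_def rip_add_right rip_self rip_self_radjoint[of d "A\<^sup>\<dagger>", simplified])
  also have "\<dots> = 2 * (d \<odot> (A v - S v)) - 2 * ((A\<^sup>\<dagger>) d \<odot> ((A\<^sup>\<dagger>) (S v) - (S\<^sup>\<dagger>) (S v)))"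
    unfolding eq by (simp add: rip_radjoint' rip_scaleR_right rip_diff_right[of d "A v - S v"])
  also have "\<dots> \<le> 2 * (norm d * a) + 2 * (q * b)"
    using abs_rip_le_norm[of d "A v - S v"]
      abs_rip_le_norm[of "(A\<^sup>\<dagger>) d" "(A\<^sup>\<dagger>) (S v) - (S\<^sup>\<dagger>) (S v)"]
    unfolding a_def b_def q_def by linarith
  finally have "norm d * (norm d - 2 * a) \<le> 2 * (q * b) - q\<^sup>2"
    by (simp add: power2_eq_square algebra_simps)
  also have "\<dots> \<le> b * b"
    using zero_le_power2[of "q - b"] by (simp add: power2_eq_square algebra_simps)
  also have "b * b \<le> b * (norm d - 2 * a)" using d ab by (intro mult_left_mono) auto
  also have "\<dots> < norm d * (norm d - 2 * a)" using d ab by (intro mult_strict_right_mono) auto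
  finally show False by simp
qed

section \<open>Strong and strong-* closures\<close>

definition strong_star_closure :: "('x \<Rightarrow>\<^sub>L 'x) set \<Rightarrow> ('x \<Rightarrow>\<^sub>L 'x) set"
  where "strong_star_closure C = {S. \<forall>F e. finite F \<longrightarrow> e > 0 \<longrightarrow>
    (\<exists>A\<in>C. \<forall>v\<in>F. norm (blinfun_apply A v - blinfun_apply S v) < e \<and>
      norm (blinfun_apply (A\<^sup>\<dagger>) v - blinfun_apply (S\<^sup>\<dagger>) v) < e)}"

lemma strong_star_closureD:
  assumes "S \<in> strong_star_closure C" "finite F" "e > 0"
  obtains A where "A \<in> C" "\<And>v. v \<in> F \<Longrightarrow> norm (blinfun_apply A v - blinfun_apply S v) < e"
    "\<And>v. v \<in> F \<Longrightarrow> norm (blinfun_apply (A\<^sup>\<dagger>) v - blinfun_apply (S\<^sup>\<dagger>) v) < e"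
  using assms unfolding strong_star_closure_def by blast

lemma strong_star_closureI:
  assumes "\<And>F e. \<lbrakk>finite F; e > 0\<rbrakk> \<Longrightarrow>
    \<exists>A\<in>C. \<forall>v\<in>F. norm (blinfun_apply A v - blinfun_apply S v) < e \<and>
      norm (blinfun_apply (A\<^sup>\<dagger>) v - blinfun_apply (S\<^sup>\<dagger>) v) < e"
  shows "S \<in> strong_star_closure C"
  using assms unfolding strong_star_closure_def by blast

text \<open>A linear functional \<open>A \<mapsto> \<Sum> y\<^sub>v \<odot> Av + \<Sum> z\<^sub>v \<odot> A\<^sup>\<dagger>v\<close> equals \<open>\<Sum> y\<^sub>v \<odot> Av + \<Sum> Az\<^sub>v \<odot> v\<close>,
  so it is strongly continuous: if it vanishes on \<open>C\<close>, then it vanishes on \<open>cl_s C\<close>.  By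
  \<open>dense_if_orthogonal_vanish\<close> no more is needed to approximate \<open>T\<close> and \<open>T\<^sup>\<dagger>\<close> at the same time, although
  taking adjoints is not strongly continuous.\<close>

lemma cl_s_subset_strong_star_closure:
  assumes C: "subspace C"
  shows "cl_s C \<subseteq> strong_star_closure C"
proof
  fix T assume T: "T \<in> cl_s C"
  show "T \<in> strong_star_closure C"
  proof (rule strong_star_closureI)
    fix F :: "'x set" and e :: real assume F: "finite F" and e: "e > 0"
    define L where "L i A = (if snd i then A (fst i) else (A\<^sup>\<dagger>) (fst i))"
      for i :: "'x \<times> bool" and A :: "'x \<Rightarrow>\<^sub>L 'x"
    let ?I = "F \<times> (UNIV :: bool set)"
    have I: "finite ?I" using F by simp
    have "\<exists>A\<in>C. \<forall>i\<in>?I. norm (L i A - L i T) < e"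
    proof (rule dense_if_orthogonal_vanish[OF I C _ _ e])
      show "linear (L i)" for i
        by (rule linearI) (auto simp: L_def radjoint_add radjoint_scaleR blinfun.bilinear_simps)
    next
      fix y assume y: "\<And>A. A \<in> C \<Longrightarrow> (\<Sum>i\<in>?I. y i \<odot> L i A) = 0"
      have L: "y i \<odot> L i A = (if snd i then y i \<odot> A (fst i) else A (y i) \<odot> fst i)" for i and A :: "'x \<Rightarrow>\<^sub>L 'x"
        by (simp add: L_def rip_radjoint)
      define M where "M = (\<Sum>i\<in>?I. norm (y i) + norm (fst i)) + 1"
      have M: "M \<ge> 1" unfolding M_def by (simp add: sum_nonneg)
      let ?s = "\<Sum>i\<in>?I. y i \<odot> L i T"
      show "?s = 0"
      proof (rule ccontr)
        assume s: "?s \<noteq> 0"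
        define \<eta> where "\<eta> = \<bar>?s\<bar> / M"
        have \<eta>: "\<eta> > 0" using s M by (simp add: \<eta>_def)
        have "finite (F \<union> y ` ?I)" using F by simp
        then obtain A where A: "A \<in> C" "\<And>v. v \<in> F \<union> y ` ?I \<Longrightarrow> norm (A v - T v) < \<eta>"
          by (rule in_cl_sD[OF T _ \<eta>]) simp
        have "\<bar>y i \<odot> L i T - y i \<odot> L i A\<bar> \<le> \<eta> * (norm (y i) + norm (fst i))" if i: "i \<in> ?I" for i
        proof (cases "snd i")
          case True
          have "norm (T (fst i) - A (fst i)) \<le> \<eta>"
            using A(2)[of "fst i"] i by (auto simp: norm_minus_commute)
          then have "norm (y i) * norm (T (fst i) - A (fst i)) \<le> norm (y i) * \<eta>"
            by (simp add: mult_left_mono)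
          moreover have "0 \<le> \<eta> * norm (fst i)" using \<eta> by simp
          ultimately show ?thesis
            using abs_rip_le_norm[of "y i" "T (fst i) - A (fst i)"] True
            by (simp add: L rip_diff_right algebra_simps)
        next
          case False
          have "norm (T (y i) - A (y i)) \<le> \<eta>"
            using A(2)[of "y i"] i by (auto simp: norm_minus_commute)
          then have "norm (T (y i) - A (y i)) * norm (fst i) \<le> \<eta> * norm (fst i)"
            by (simp add: mult_right_mono)
          moreover have "0 \<le> \<eta> * norm (y i)" using \<eta> by simp
          ultimately show ?thesis
            using abs_rip_le_norm[of "T (y i) - A (y i)" "fst i"] False
            by (simp add: L rip_diff_left algebra_simps)
        qed
        then have "(\<Sum>i\<in>?I. \<bar>y i \<odot> L i T - y i \<odot> L i A\<bar>) \<le> \<eta> * (M - 1)"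
          unfolding M_def by (simp add: sum_distrib_left sum_mono)
        moreover have "\<bar>?s\<bar> = \<bar>\<Sum>i\<in>?I. y i \<odot> L i T - y i \<odot> L i A\<bar>"
          using y[OF A(1)] by (simp add: sum_subtractf)
        ultimately have "\<bar>?s\<bar> \<le> \<eta> * (M - 1)"
          using sum_abs[of "\<lambda>i. y i \<odot> L i T - y i \<odot> L i A" ?I] by linarith
        also have "\<dots> < \<eta> * M" using \<eta> by simp
        also have "\<dots> = \<bar>?s\<bar>" using M by (simp add: \<eta>_def)
        finally show False by simp
      qed
    qed
    then obtain A where A: "A \<in> C" "\<And>i. i \<in> ?I \<Longrightarrow> norm (L i A - L i T) < e" by blast
    have "norm (A v - T v) < e \<and> norm ((A\<^sup>\<dagger>) v - (T\<^sup>\<dagger>) v) < e" if "v \<in> F" for v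
      using A(2)[of "(v, True)"] A(2)[of "(v, False)"] that by (simp add: L_def)
    then show "\<exists>A\<in>C. \<forall>v\<in>F. norm (blinfun_apply A v - T v) < e \<and> norm ((A\<^sup>\<dagger>) v - (T\<^sup>\<dagger>) v) < e"
      by (intro bexI[OF _ A(1)]) simp
  qed
qed

end

locale real_star_algebra = real_hilbert_space rip
  for rip :: "'x::banach \<Rightarrow> 'x \<Rightarrow> real" (infixl "\<odot>" 70) +
  fixes C :: "('x \<Rightarrow>\<^sub>L 'x) set"
  assumes subspace_C: "subspace C"
    and compose_C: "\<lbrakk>S \<in> C; T \<in> C\<rbrakk> \<Longrightarrow> S o\<^sub>L T \<in> C"
    and radjoint_C: "T \<in> C \<Longrightarrow> T\<^sup>\<dagger> \<in> C"
    and closed_C: "closed C"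
begin

lemma strong_star_closure_add:
  assumes S: "S \<in> strong_star_closure C" and T: "T \<in> strong_star_closure C"
  shows "S + T \<in> strong_star_closure C"
proof (rule strong_star_closureI)
  fix F :: "'x set" and e :: real assume F: "finite F" and e: "e > 0"
  obtain A where A: "A \<in> C" "\<And>v. v \<in> F \<Longrightarrow> norm (A v - S v) < e/2"
    "\<And>v. v \<in> F \<Longrightarrow> norm ((A\<^sup>\<dagger>) v - (S\<^sup>\<dagger>) v) < e/2"
    by (rule strong_star_closureD[OF S F, of "e/2"]) (use e in simp, rule that)
  obtain B where B: "B \<in> C" "\<And>v. v \<in> F \<Longrightarrow> norm (B v - T v) < e/2"
    "\<And>v. v \<in> F \<Longrightarrow> norm ((B\<^sup>\<dagger>) v - (T\<^sup>\<dagger>) v) < e/2"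
    by (rule strong_star_closureD[OF T F, of "e/2"]) (use e in simp, rule that)
  have "norm ((A + B) v - (S + T) v) < e \<and> norm (((A + B)\<^sup>\<dagger>) v - ((S + T)\<^sup>\<dagger>) v) < e"
    if "v \<in> F" for v
    using A(2,3)[OF that] B(2,3)[OF that]
      norm_diff_triangle_ineq[of "A v" "B v" "S v" "T v"]
      norm_diff_triangle_ineq[of "(A\<^sup>\<dagger>) v" "(B\<^sup>\<dagger>) v" "(S\<^sup>\<dagger>) v" "(T\<^sup>\<dagger>) v"]
    by (simp add: radjoint_add blinfun.bilinear_simps)
  then show "\<exists>A\<in>C. \<forall>v\<in>F. norm (blinfun_apply A v - (S + T) v) < e \<and> norm ((A\<^sup>\<dagger>) v - ((S + T)\<^sup>\<dagger>) v) < e"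
    by (intro bexI[of _ "A + B"] ballI) (use subspace_add[OF subspace_C A(1) B(1)] in auto)
qed

lemma strong_star_closure_scaleR:
  assumes S: "S \<in> strong_star_closure C"
  shows "r *\<^sub>R S \<in> strong_star_closure C"
proof (rule strong_star_closureI)
  fix F :: "'x set" and e :: real assume F: "finite F" and e: "e > 0"
  obtain A where A: "A \<in> C" "\<And>v. v \<in> F \<Longrightarrow> norm (A v - S v) < e / (\<bar>r\<bar> + 1)"
    "\<And>v. v \<in> F \<Longrightarrow> norm ((A\<^sup>\<dagger>) v - (S\<^sup>\<dagger>) v) < e / (\<bar>r\<bar> + 1)"
    by (rule strong_star_closureD[OF S F, of "e / (\<bar>r\<bar> + 1)"]) (use e in \<open>simp add: add_nonneg_pos\<close>, rule that)
  have small: "norm (r *\<^sub>R x - r *\<^sub>R y) < e" if "norm (x - y) < e / (\<bar>r\<bar> + 1)" for x y :: 'x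
  proof -
    have "norm (r *\<^sub>R x - r *\<^sub>R y) \<le> (\<bar>r\<bar> + 1) * norm (x - y)"
      by (simp add: algebra_simps flip: scaleR_diff_right)
    also have "\<dots> < e" using that by (simp add: field_simps add_pos_nonneg)
    finally show ?thesis .
  qed
  have "norm ((r *\<^sub>R A) v - (r *\<^sub>R S) v) < e \<and> norm (((r *\<^sub>R A)\<^sup>\<dagger>) v - ((r *\<^sub>R S)\<^sup>\<dagger>) v) < e"
    if "v \<in> F" for v
    using A(2,3)[OF that] small by (simp add: radjoint_scaleR blinfun.bilinear_simps)
  then show "\<exists>A\<in>C. \<forall>v\<in>F. norm (blinfun_apply A v - (r *\<^sub>R S) v) < e \<and> norm ((A\<^sup>\<dagger>) v - ((r *\<^sub>R S)\<^sup>\<dagger>) v) < e"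
    by (intro bexI[of _ "r *\<^sub>R A"] ballI) (use subspace_scale[OF subspace_C A(1)] in auto)
qed

lemma strong_star_closure_radjoint: "S \<in> strong_star_closure C \<Longrightarrow> S\<^sup>\<dagger> \<in> strong_star_closure C"
proof (rule strong_star_closureI)
  fix F :: "'x set" and e :: real
  assume S: "S \<in> strong_star_closure C" and F: "finite F" and e: "e > 0"
  obtain A where "A \<in> C" "\<And>v. v \<in> F \<Longrightarrow> norm (A v - S v) < e"
    "\<And>v. v \<in> F \<Longrightarrow> norm ((A\<^sup>\<dagger>) v - (S\<^sup>\<dagger>) v) < e"
    by (rule strong_star_closureD[OF S F e]) (rule that)
  then show "\<exists>A\<in>C. \<forall>v\<in>F. norm (blinfun_apply A v - (S\<^sup>\<dagger>) v) < e \<and> norm ((A\<^sup>\<dagger>) v - (S\<^sup>\<dagger>\<^sup>\<dagger>) v) < e"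
    by (intro bexI[of _ "A\<^sup>\<dagger>"] radjoint_C) auto
qed

text \<open>Multiplication is not jointly continuous, so \<open>A\<close> is chosen first and the tolerance for \<open>B\<close>
  then depends on \<open>\<parallel>A\<parallel>\<close>.\<close>

lemma strong_star_closure_compose:
  assumes S: "S \<in> strong_star_closure C" and T: "T \<in> strong_star_closure C"
  shows "S o\<^sub>L T \<in> strong_star_closure C"
proof (rule strong_star_closureI)
  fix F :: "'x set" and e :: real assume F: "finite F" and e: "e > 0"
  have half: "d * (e / (2 * d)) = e/2" if "d > 0" for d :: real using that by simp
  define \<eta> where "\<eta> = e / (2 * (norm T + 1))"
  have nT: "norm T + 1 > 0" by (simp add: add_nonneg_pos)
  have \<eta>: "\<eta> > 0" "(norm T + 1) * \<eta> = e/2"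
    using e nT half[OF nT] by (simp_all add: \<eta>_def)
  have fin: "finite (F \<union> T ` F)" using F by simp
  obtain A where A: "A \<in> C" "\<And>v. v \<in> F \<union> T ` F \<Longrightarrow> norm (A v - S v) < min (e/2) \<eta>"
    "\<And>v. v \<in> F \<union> T ` F \<Longrightarrow> norm ((A\<^sup>\<dagger>) v - (S\<^sup>\<dagger>) v) < min (e/2) \<eta>"
    by (rule strong_star_closureD[OF S fin, of "min (e/2) \<eta>"]) (use e \<eta> in simp, rule that)
  define \<theta> where "\<theta> = e / (2 * (norm A + 1))"
  have nA: "norm A + 1 > 0" by (simp add: add_nonneg_pos)
  have \<theta>: "\<theta> > 0" "(norm A + 1) * \<theta> = e/2"
    using e nA half[OF nA] by (simp_all add: \<theta>_def)
  have fin': "finite (F \<union> A\<^sup>\<dagger> ` F)" using F by simp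
  obtain B where B: "B \<in> C" "\<And>v. v \<in> F \<union> A\<^sup>\<dagger> ` F \<Longrightarrow> norm (B v - T v) < min (e/2) \<theta>"
    "\<And>v. v \<in> F \<union> A\<^sup>\<dagger> ` F \<Longrightarrow> norm ((B\<^sup>\<dagger>) v - (T\<^sup>\<dagger>) v) < min (e/2) \<theta>"
    by (rule strong_star_closureD[OF T fin', of "min (e/2) \<theta>"]) (use e \<theta> in simp, rule that)
  have small: "norm (U x) \<le> e/2" if "norm x < c" "(norm U + 1) * c = e/2" for x c and U :: "'x \<Rightarrow>\<^sub>L 'x"
  proof -
    have "norm (U x) \<le> norm U * norm x" by (rule norm_blinfun)
    also have "\<dots> \<le> (norm U + 1) * c" using that(1) by (intro mult_mono) auto
    finally show ?thesis using that(2) by simp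
  qed
  have "norm ((A o\<^sub>L B) v - (S o\<^sub>L T) v) < e" if v: "v \<in> F" for v
  proof -
    have eq: "(A o\<^sub>L B) v - (S o\<^sub>L T) v = A (B v - T v) + (A (T v) - S (T v))"
      by (simp add: blinfun.bilinear_simps)
    have "norm (A (B v - T v)) \<le> e/2" using B(2)[of v] v \<theta>(2) by (intro small) auto
    moreover have "norm (A (T v) - S (T v)) < e/2" using A(2)[of "T v"] v by auto
    ultimately show ?thesis
      unfolding eq
      using norm_triangle_ineq[of "A (B v - T v)" "A (T v) - S (T v)"] by linarith
  qed
  moreover have "norm (((A o\<^sub>L B)\<^sup>\<dagger>) v - ((S o\<^sub>L T)\<^sup>\<dagger>) v) < e" if v: "v \<in> F" for v
  proof -
    have eq: "((A o\<^sub>L B)\<^sup>\<dagger>) v - ((S o\<^sub>L T)\<^sup>\<dagger>) v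
        = (T\<^sup>\<dagger>) ((A\<^sup>\<dagger>) v - (S\<^sup>\<dagger>) v) + ((B\<^sup>\<dagger>) ((A\<^sup>\<dagger>) v) - (T\<^sup>\<dagger>) ((A\<^sup>\<dagger>) v))"
      by (simp add: radjoint_compose blinfun.bilinear_simps)
    have "norm ((T\<^sup>\<dagger>) ((A\<^sup>\<dagger>) v - (S\<^sup>\<dagger>) v)) \<le> e/2"
      using A(3)[of v] v \<eta>(2) by (intro small[of _ \<eta>]) auto
    moreover have "norm ((B\<^sup>\<dagger>) ((A\<^sup>\<dagger>) v) - (T\<^sup>\<dagger>) ((A\<^sup>\<dagger>) v)) < e/2"
      using B(3)[of "(A\<^sup>\<dagger>) v"] v by auto
    ultimately show ?thesis
      unfolding eq
      using norm_triangle_ineq[of "(T\<^sup>\<dagger>) ((A\<^sup>\<dagger>) v - (S\<^sup>\<dagger>) v)" "(B\<^sup>\<dagger>) ((A\<^sup>\<dagger>) v) - (T\<^sup>\<dagger>) ((A\<^sup>\<dagger>) v)"]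
      by linarith
  qed
  ultimately show "\<exists>A\<in>C. \<forall>v\<in>F. norm (blinfun_apply A v - (S o\<^sub>L T) v) < e \<and> norm ((A\<^sup>\<dagger>) v - ((S o\<^sub>L T)\<^sup>\<dagger>) v) < e"
    by (intro bexI[OF _ compose_C[OF A(1) B(1)]]) simp
qed

lemma closed_strong_star_closure: "closed (strong_star_closure C)"
  unfolding closed_limpt islimpt_approachable
proof (intro allI impI strong_star_closureI)
  fix S and F :: "'x set" and e :: real
  assume lim: "\<forall>e>0. \<exists>R\<in>strong_star_closure C. R \<noteq> S \<and> dist R S < e"
    and F: "finite F" and e: "e > 0"
  define M where "M = (\<Sum>v\<in>F. norm v) + 1"
  have M: "M > 0" "\<And>v. v \<in> F \<Longrightarrow> norm v \<le> M"
    unfolding M_def using member_le_sum[OF _ _ F, of _ norm]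
    by (auto simp: add_nonneg_pos sum_nonneg intro: add_increasing2)
  obtain R where R: "R \<in> strong_star_closure C" "norm (R - S) < e / (2 * M)"
    using lim e M(1) unfolding dist_norm by (metis divide_pos_pos mult_pos_pos zero_less_numeral)
  obtain A where A: "A \<in> C" "\<And>v. v \<in> F \<Longrightarrow> norm (A v - R v) < e/2"
    "\<And>v. v \<in> F \<Longrightarrow> norm ((A\<^sup>\<dagger>) v - (R\<^sup>\<dagger>) v) < e/2"
    by (rule strong_star_closureD[OF R(1) F, of "e/2"]) (use e in simp, rule that)
  have small: "norm (U v) \<le> e/2" if "v \<in> F" "norm U < e / (2 * M)" for v and U :: "'x \<Rightarrow>\<^sub>L 'x"
  proof -
    have "norm (U v) \<le> norm U * norm v" by (rule norm_blinfun)
    also have "\<dots> \<le> (e / (2 * M)) * M" using that M e by (intro mult_mono) auto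
    finally show ?thesis using M by simp
  qed
  have "norm (A v - S v) < e \<and> norm ((A\<^sup>\<dagger>) v - (S\<^sup>\<dagger>) v) < e" if v: "v \<in> F" for v
  proof
    have "norm ((R - S) v) \<le> e/2" "norm (((R - S)\<^sup>\<dagger>) v) \<le> e/2"
      using small[OF v, of "R - S"] small[OF v, of "(R - S)\<^sup>\<dagger>"] R(2) by auto
    then have 1: "norm (R v - S v) \<le> e/2" and 2: "norm ((R\<^sup>\<dagger>) v - (S\<^sup>\<dagger>) v) \<le> e/2"
      by (simp_all add: radjoint_diff blinfun.bilinear_simps)
    show "norm (A v - S v) < e"
      using norm_triangle_ineq[of "A v - R v" "R v - S v"] A(2)[OF v] 1 by simp
    show "norm ((A\<^sup>\<dagger>) v - (S\<^sup>\<dagger>) v) < e"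
      using norm_triangle_ineq[of "(A\<^sup>\<dagger>) v - (R\<^sup>\<dagger>) v" "(R\<^sup>\<dagger>) v - (S\<^sup>\<dagger>) v"] A(3)[OF v] 2 by simp
  qed
  then show "\<exists>A\<in>C. \<forall>v\<in>F. norm (blinfun_apply A v - S v) < e \<and> norm ((A\<^sup>\<dagger>) v - (S\<^sup>\<dagger>) v) < e"
    by (intro bexI[OF _ A(1)]) simp
qed

section \<open>Density of the unit ball\<close>

text \<open>The map \<open>B \<mapsto> B(1 - t(1 + A\<^sup>\<dagger>A)) + 2tA\<close> preserves \<open>C\<close> even if \<open>C\<close> does not contain the
  identity operator, since all its terms have a factor \<open>A\<close> or \<open>B\<close>.\<close>

lemma ex_kaplansky_pair_in_C:
  assumes A: "A \<in> C"
  shows "\<exists>B\<in>C. kaplansky_pair A B"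
proof -
  define t where "t = 1 / (1 + (norm A)\<^sup>2)"
  define Q where "Q = (1 - t) *\<^sub>R id_blinfun - t *\<^sub>R (A\<^sup>\<dagger> o\<^sub>L A)"
  define f where "f B = (1 - t) *\<^sub>R B - t *\<^sub>R (B o\<^sub>L (A\<^sup>\<dagger> o\<^sub>L A)) + (2 * t) *\<^sub>R A" for B
  have "1 + (norm A)\<^sup>2 > 0" by (simp add: add_pos_nonneg)
  then have t: "t > 0" "t \<le> 1" by (auto simp: t_def field_simps)
  have Q: "norm Q \<le> 1 - t" unfolding Q_def t_def by (rule norm_id_minus_square_le)
  have "f ` C \<subseteq> C"
    unfolding f_def using subspace_C A
    by (auto intro!: subspace_add subspace_diff subspace_scale compose_C radjoint_C)
  moreover have "dist (f B) (f B') \<le> (1 - t) * dist B B'" for B B'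
  proof -
    have "f B - f B' = (B - B') o\<^sub>L Q"
      by (rule blinfun_eqI) (simp add: f_def Q_def blinfun.bilinear_simps algebra_simps)
    then have "dist (f B) (f B') \<le> norm (B - B') * norm Q"
      by (simp add: dist_norm norm_blinfun_compose)
    also have "\<dots> \<le> norm (B - B') * (1 - t)" using Q by (simp add: mult_left_mono)
    finally show ?thesis by (simp add: dist_norm mult.commute)
  qed
  moreover have "C \<noteq> {}" "complete C" using A closed_C by (auto simp: complete_eq_closed)
  ultimately obtain B where B: "B \<in> C" "f B = B"
    using Banach_fix[of C "1 - t" f] t by auto
  have "kaplansky_pair A B"
    unfolding kaplansky_pair_def
  proof
    fix v
    have "f B v = B v" using B by simp
    then have "t *\<^sub>R B (v + (A\<^sup>\<dagger>) (A v)) = t *\<^sub>R (2 *\<^sub>R A v)"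
      by (simp add: f_def blinfun.bilinear_simps algebra_simps)
    then show "B (v + (A\<^sup>\<dagger>) (A v)) = 2 *\<^sub>R A v"
      by (rule scaleR_left_imp_eq[rotated]) (use t in simp)
  qed
  then show ?thesis using B(1) by blast
qed

text \<open>On operators of norm less than one the transform is inverted by solving \<open>2S = T(1 + S\<^sup>\<dagger>S)\<close>
  with the contraction \<open>S \<mapsto> T(1 + S\<^sup>\<dagger>S)/2\<close>, whose Lipschitz constant is \<open>r\<^sup>2\<close>.  This takes the place of the
  inverse function $t/(1+\sqrt{1-t^2})$ and keeps \<open>S\<close> in the strong-* closure.  Uniqueness
  serves to transfer selfadjointness from \<open>T\<close> to \<open>S\<close>.\<close>

lemma ex1_kaplansky_preimage:
  assumes T: "T \<in> strong_star_closure C" "norm T \<le> r" and r: "r < 1"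
  shows "\<exists>!S. (S \<in> strong_star_closure C \<and> norm S \<le> r) \<and> kaplansky_pair S T"
proof -
  define D where "D = {S \<in> strong_star_closure C. norm S \<le> r}"
  define f where "f S = (1/2) *\<^sub>R (T + (T o\<^sub>L (S\<^sup>\<dagger> o\<^sub>L S)))" for S
  have r0: "r \<ge> 0" using T(2) norm_ge_zero order_trans by blast
  have "r\<^sup>2 < 1" using r r0 by (simp add: abs_square_less_1)
  then have rr: "r\<^sup>2 < 1" "r\<^sup>2 \<le> 1" by simp_all
  have img: "f S \<in> D" if "S \<in> D" for S
  proof -
    have S: "S \<in> strong_star_closure C" "norm S \<le> r" using that by (auto simp: D_def)
    have "norm (T o\<^sub>L (S\<^sup>\<dagger> o\<^sub>L S)) \<le> norm T * (norm (S\<^sup>\<dagger>) * norm S)"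
      by (meson norm_blinfun_compose norm_ge_zero mult_left_mono order_trans)
    also have "\<dots> \<le> r * (r * r)" using S(2) T(2) r0 by (intro mult_mono) auto
    also have "\<dots> \<le> r * 1" using rr r0 by (intro mult_left_mono) (auto simp: power2_eq_square)
    finally have "norm (f S) \<le> r"
      unfolding f_def using norm_triangle_ineq[of T "T o\<^sub>L (S\<^sup>\<dagger> o\<^sub>L S)"] T(2) by simp
    then show ?thesis unfolding D_def f_def
      using S T by (auto intro!: strong_star_closure_add strong_star_closure_scaleR
          strong_star_closure_compose strong_star_closure_radjoint)
  qed
  have lip: "dist (f S) (f R) \<le> r\<^sup>2 * dist S R" if "S \<in> D" "R \<in> D" for S R
  proof -
    have SR: "norm S \<le> r" "norm R \<le> r" using that by (auto simp: D_def)
    have "f S - f R = (1/2) *\<^sub>R (T o\<^sub>L ((S\<^sup>\<dagger> o\<^sub>L (S - R)) + ((S - R)\<^sup>\<dagger> o\<^sub>L R)))"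
      by (rule blinfun_eqI) (simp add: f_def radjoint_diff blinfun.bilinear_simps algebra_simps)
    also have "norm \<dots> \<le> (1/2) * (norm T * (norm (S\<^sup>\<dagger> o\<^sub>L (S - R)) + norm ((S - R)\<^sup>\<dagger> o\<^sub>L R)))"
      by simp (meson norm_blinfun_compose norm_triangle_ineq norm_ge_zero mult_left_mono order_trans)
    also have "\<dots> \<le> (1/2) * (r * (r * norm (S - R) + norm (S - R) * r))"
    proof -
      have "norm (S\<^sup>\<dagger> o\<^sub>L (S - R)) \<le> r * norm (S - R)"
        using norm_blinfun_compose[of "S\<^sup>\<dagger>" "S - R"] SR(1)
        by (simp add: mult_right_mono order_trans[OF _ mult_right_mono])
      moreover have "norm ((S - R)\<^sup>\<dagger> o\<^sub>L R) \<le> norm (S - R) * r"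
        using norm_blinfun_compose[of "(S - R)\<^sup>\<dagger>" R] SR(2)
        by (simp add: order_trans[OF _ mult_left_mono])
      ultimately show ?thesis using T(2) r0 by (intro mult_left_mono mult_mono add_mono) auto
    qed
    finally show ?thesis by (simp add: dist_norm power2_eq_square mult_ac)
  qed
  have "0 \<in> strong_star_closure C" using strong_star_closure_scaleR[OF T(1), of 0] by simp
  then have ne: "D \<noteq> {}" using r0 by (auto simp: D_def)
  have "D = strong_star_closure C \<inter> cball 0 r" by (auto simp: D_def)
  then have compl: "complete D" by (simp add: complete_eq_closed closed_strong_star_closure closed_Int)
  have ex1: "\<exists>!S\<in>D. f S = S"
    by (rule Banach_fix[OF compl ne _ rr(1)]) (use img lip in auto)
  have iff: "f S = S \<longleftrightarrow> kaplansky_pair S T" for S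
  proof -
    have "(1/2) *\<^sub>R Y = S \<longleftrightarrow> Y = 2 *\<^sub>R S" for Y :: "'x \<Rightarrow>\<^sub>L 'x"
      by auto
    then have "f S = S \<longleftrightarrow> T + (T o\<^sub>L (S\<^sup>\<dagger> o\<^sub>L S)) = 2 *\<^sub>R S"
      unfolding f_def .
    also have "\<dots> \<longleftrightarrow> (\<forall>v. (T + (T o\<^sub>L (S\<^sup>\<dagger> o\<^sub>L S))) v = (2 *\<^sub>R S) v)"
      by (auto intro: blinfun_eqI)
    also have "\<dots> \<longleftrightarrow> kaplansky_pair S T"
      by (simp add: kaplansky_pair_def blinfun.bilinear_simps)
    finally show ?thesis .
  qed
  show ?thesis using ex1 unfolding iff D_def mem_Collect_eq .
qed

lemma kaplansky_approximation:
  assumes T: "T \<in> cl_s C" "norm T \<le> 1" and F: "finite F" and e: "e > 0"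
  shows "\<exists>B\<in>C. norm B \<le> 1 \<and> (T\<^sup>\<dagger> = T \<longrightarrow> B\<^sup>\<dagger> = B) \<and> (\<forall>x\<in>F. norm (B x - T x) < e)"
proof -
  define M where "M = (\<Sum>v\<in>F. norm v) + 1"
  have M: "M > 0" "\<And>v. v \<in> F \<Longrightarrow> norm v \<le> M"
    unfolding M_def using member_le_sum[OF _ _ F, of _ norm]
    by (auto simp: add_nonneg_pos sum_nonneg intro: add_increasing2)
  \<comment> \<open>The preimage exists only below norm one, so \<open>T\<close> is first shrunk by a factor close to one.\<close>
  define r where "r = 1 - min (1/2) (e / (4 * M))"
  have r: "r < 1" "r > 0" "(1 - r) * M \<le> e/4"
  proof -
    show "r < 1" using e M by (simp add: r_def)
    show "r > 0" by (simp add: r_def min_def)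
    have "(1 - r) * M \<le> (e / (4 * M)) * M" using M by (intro mult_right_mono) (auto simp: r_def)
    then show "(1 - r) * M \<le> e/4" using M by simp
  qed
  define T' where "T' = r *\<^sub>R T"
  have T'star: "T' \<in> strong_star_closure C"
    unfolding T'_def using T(1) cl_s_subset_strong_star_closure[OF subspace_C]
    by (intro strong_star_closure_scaleR) auto
  have T'norm: "norm T' \<le> r" using T(2) r by (simp add: T'_def)
  obtain S where S: "S \<in> strong_star_closure C" "norm S \<le> r" "kaplansky_pair S T'"
    and uniq: "\<And>R. \<lbrakk>R \<in> strong_star_closure C; norm R \<le> r; kaplansky_pair R T'\<rbrakk> \<Longrightarrow> R = S"
    using ex1_kaplansky_preimage[OF T'star T'norm r(1)] by blast
  have S_sa: "S\<^sup>\<dagger> = S" if "T\<^sup>\<dagger> = T"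
  proof (rule uniq)
    have "T'\<^sup>\<dagger> = T'" using that by (simp add: T'_def radjoint_scaleR)
    then show "kaplansky_pair (S\<^sup>\<dagger>) T'" using kaplansky_pair_radjoint[OF S(3)] by simp
  qed (use S strong_star_closure_radjoint in auto)
  have "\<exists>v. v + (S\<^sup>\<dagger>) (S v) = x" for x using one_plus_square_surj by blast
  then obtain v where v: "\<And>x. v x + (S\<^sup>\<dagger>) (S (v x)) = x" by metis
  \<comment> \<open>The vectors at which \<open>kaplansky_pair_dist_le\<close> compares \<open>A\<close> with \<open>S\<close>.\<close>
  define G where "G = v ` F \<union> (\<lambda>x. S (v x)) ` F"
  have G: "finite G" using F by (simp add: G_def)
  obtain A\<^sub>0 where A0: "A\<^sub>0 \<in> C" "\<And>u. u \<in> G \<Longrightarrow> norm (A\<^sub>0 u - S u) < e/6"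
    "\<And>u. u \<in> G \<Longrightarrow> norm ((A\<^sub>0\<^sup>\<dagger>) u - (S\<^sup>\<dagger>) u) < e/6"
    by (rule strong_star_closureD[OF S(1) G, of "e/6"]) (use e in simp, rule that)
  obtain A where A: "A \<in> C" "\<And>u. u \<in> G \<Longrightarrow> norm (A u - S u) < e/6"
    "\<And>u. u \<in> G \<Longrightarrow> norm ((A\<^sup>\<dagger>) u - (S\<^sup>\<dagger>) u) < e/6" and A_sa: "T\<^sup>\<dagger> = T \<longrightarrow> A\<^sup>\<dagger> = A"
  proof (cases "T\<^sup>\<dagger> = T")
    case False
    then show ?thesis by (intro that[OF A0]) simp_all
  next
    case True
    define A where "A = (1/2) *\<^sub>R (A\<^sub>0 + A\<^sub>0\<^sup>\<dagger>)"
    have A: "A\<^sup>\<dagger> = A" "A \<in> C"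
      using A0(1) subspace_C
      by (auto simp: A_def radjoint_scaleR radjoint_add add.commute intro!: subspace_scale subspace_add radjoint_C)
    have "norm (A u - S u) < e/6" if u: "u \<in> G" for u
    proof -
      have "A u - S u = (1/2) *\<^sub>R ((A\<^sub>0 u - S u) + ((A\<^sub>0\<^sup>\<dagger>) u - S u))"
        by (simp add: A_def blinfun.bilinear_simps algebra_simps flip: scaleR_left.add)
      then show ?thesis
        using norm_triangle_ineq[of "A\<^sub>0 u - S u" "(A\<^sub>0\<^sup>\<dagger>) u - S u"] A0(2,3)[OF u] S_sa[OF True] by simp
    qed
    note close = this
    show ?thesis
    proof (rule that[OF A(2) close])
      show "norm ((A\<^sup>\<dagger>) u - (S\<^sup>\<dagger>) u) < e/6" if "u \<in> G" for u
        unfolding A(1) S_sa[OF True] by (rule close[OF that])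
      show "T\<^sup>\<dagger> = T \<longrightarrow> A\<^sup>\<dagger> = A" using A(1) by simp
    qed
  qed
  obtain B where B: "B \<in> C" "kaplansky_pair A B" using ex_kaplansky_pair_in_C[OF A(1)] by (elim bexE) (rule that)
  have "B\<^sup>\<dagger> = B" if "T\<^sup>\<dagger> = T"
  proof (rule kaplansky_pair_unique[OF _ B(2)])
    show "kaplansky_pair A (B\<^sup>\<dagger>)"
      using kaplansky_pair_radjoint[OF B(2)] A_sa that by simp
  qed
  moreover have "norm (B x - T x) < e" if x: "x \<in> F" for x
  proof -
    have "norm (B x - T' x) \<le> 2 * norm (A (v x) - S (v x)) + norm ((A\<^sup>\<dagger>) (S (v x)) - (S\<^sup>\<dagger>) (S (v x)))"
      by (rule kaplansky_pair_dist_le[OF B(2) S(3) v])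
    also have "\<dots> < e/2"
      using A(2)[of "v x"] A(3)[of "S (v x)"] x by (auto simp: G_def)
    finally have 1: "norm (B x - T' x) < e/2" .
    have "norm (T x) \<le> 1 * M"
      using norm_blinfun[of T x] T(2) M(2)[OF x] by (meson mult_mono norm_ge_zero order_trans zero_le_one)
    then have "(1 - r) * norm (T x) \<le> (1 - r) * M" using r by (intro mult_left_mono) auto
    then have small: "(1 - r) * norm (T x) \<le> e/4" using r(3) by (rule order_trans)
    have "T' x - T x = (r - 1) *\<^sub>R T x"
      by (simp add: T'_def blinfun.bilinear_simps algebra_simps)
    then have "norm (T' x - T x) = (1 - r) * norm (T x)" using r by simp
    then have "norm (T' x - T x) \<le> e/4" using small by simp
    then show ?thesis
      using norm_triangle_ineq[of "B x - T' x" "T' x - T x"] 1 e by simp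
  qed
  ultimately show ?thesis using B kaplansky_pair_norm_le by blast
qed

theorem kaplansky_density:
  assumes "T \<in> unit_ball (cl_s C)"
  shows "T \<in> cl_s (unit_ball C)"
    and "T\<^sup>\<dagger> = T \<Longrightarrow> T \<in> cl_s {A \<in> unit_ball C. A\<^sup>\<dagger> = A}"
proof -
  have T: "T \<in> cl_s C" "norm T \<le> 1" using assms by (simp_all add: unit_ball_def)
  show "T \<in> cl_s (unit_ball C)"
    unfolding in_cl_s_iff
  proof (intro allI impI)
    fix F :: "'x set" and e :: real assume "finite F" "e > 0"
    from kaplansky_approximation[OF T this]
    obtain B where B: "B \<in> C" "norm B \<le> 1" and FB: "\<forall>x\<in>F. norm (B x - T x) < e" by blast
    then have "B \<in> unit_ball C" by (simp add: unit_ball_def)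
    with FB show "\<exists>A\<in>unit_ball C. \<forall>x\<in>F. norm (A x - T x) < e" by (rule bexI)
  qed
  assume sa: "T\<^sup>\<dagger> = T"
  show "T \<in> cl_s {A \<in> unit_ball C. A\<^sup>\<dagger> = A}"
    unfolding in_cl_s_iff
  proof (intro allI impI)
    fix F :: "'x set" and e :: real assume "finite F" "e > 0"
    from kaplansky_approximation[OF T this] sa
    obtain B where B: "B \<in> C" "norm B \<le> 1" "B\<^sup>\<dagger> = B" and FB: "\<forall>x\<in>F. norm (B x - T x) < e" by blast
    then have "B \<in> {A \<in> unit_ball C. A\<^sup>\<dagger> = A}" by (simp add: unit_ball_def)
    with FB show "\<exists>A\<in>{A \<in> unit_ball C. A\<^sup>\<dagger> = A}. \<forall>x\<in>F. norm (A x - T x) < e" by (rule bexI)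
  qed
qed

end

section \<open>Hilbert spaces over the quaternions and the octonions\<close>

context hypercomplex_hilbert_space
begin

text \<open>Both notions of adjoint imply that the real parts agree, so each of them, where it is defined,
  is the adjoint of the real Hilbert space.  Every element of \<open>C\<close> has an adjoint in the chosen sense,
  so for elements of \<open>C\<close> the two kinds of selfadjointness coincide.  The laws of \<open>hre\<close> are
  assumptions because \<open>hypercomplex\<close> is a bare signature.\<close>

lemma kaplansky_density_hypercomplex:
  assumes hre_add: "\<And>a b :: 'k. hre (a + b) = hre a + hre b"
    and hre_scaleR: "\<And>r (a :: 'k). hre (r *\<^sub>R a) = r * hre a"
    and hre_hconj: "\<And>a :: 'k. hre (hconj a) = hre a"
    and hre_one: "hre (1 :: 'k) = 1"
    and adj: "adj \<in> {K_adjoint ip, re_adjoint ip}"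
    and C: "operator_cstar_algebra lmul rmul adj C"
    and T: "T \<in> unit_ball (cl_s C)"
  shows "T \<in> cl_s (unit_ball C)"
    and "adj T T \<Longrightarrow> T \<in> cl_s {A \<in> unit_ball C. adj A A}"
proof -
  define rip where "rip x y = hre (ip x y)" for x y
  interpret real_hilbert_space rip
  proof
    fix x y z :: 'x and r :: real
    show "rip (x + y) z = rip x z + rip y z" by (simp add: rip_def ip_add_left hre_add)
    show "rip (r *\<^sub>R x) y = r * rip x y" by (simp add: rip_def ip_scaleR_left hre_scaleR)
    show "rip x y = rip y x" unfolding rip_def by (subst ip_hconj) (simp add: hre_hconj)
    obtain s where "s \<ge> 0" "ip x x = s *\<^sub>R 1" using ip_nonneg by blast
    then show "rip x x = (norm x)\<^sup>2" by (simp add: rip_def norm_ip hre_scaleR hre_one)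
  qed
  have adj_radjoint: "radjoint A = S" if "adj A S" for A S
    using that adj by (intro radjoint_eqI) (auto simp: rip_def K_adjoint_def re_adjoint_def)
  have C': "subspace C" "closed C" "\<And>S T. \<lbrakk>S \<in> C; T \<in> C\<rbrakk> \<Longrightarrow> S o\<^sub>L T \<in> C"
      "\<And>T. T \<in> C \<Longrightarrow> \<exists>S\<in>C. adj T S"
    using C unfolding operator_cstar_algebra_def by blast+
  interpret real_star_algebra rip C
    by unfold_locales (use C' adj_radjoint in blast)+
  show "T \<in> cl_s (unit_ball C)" by (rule kaplansky_density(1)[OF T])
  have "adj A A" if "A \<in> unit_ball C" "radjoint A = A" for A
  proof -
    obtain S where "adj A S" using C'(4) \<open>A \<in> unit_ball C\<close> unfolding unit_ball_def by blast
    then show ?thesis using adj_radjoint that(2) by metis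
  qed
  then have "{A \<in> unit_ball C. radjoint A = A} \<subseteq> {A \<in> unit_ball C. adj A A}" by blast
  then show "T \<in> cl_s {A \<in> unit_ball C. adj A A}" if "adj T T"
    using kaplansky_density(2)[OF T adj_radjoint[OF that]] closure_of_mono by blast
qed

end

theorem mainTheorem11:
  shows "(\<forall>(lmul :: quat \<Rightarrow> 'x::banach \<Rightarrow> 'x) rmul ip X adj C.
      quaternion_hilbert_space lmul rmul ip X \<longrightarrow>
      adj \<in> {K_adjoint ip, re_adjoint ip} \<longrightarrow>
      operator_cstar_algebra lmul rmul adj C \<longrightarrow>
        (\<forall>T \<in> unit_ball (cl_s C). T \<in> cl_s (unit_ball C)) \<and>
        (\<forall>T \<in> unit_ball (cl_s C). adj T T \<longrightarrow> T \<in> cl_s {A \<in> unit_ball C. adj A A}))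
    \<and> (\<forall>(lmul :: oct \<Rightarrow> 'x::banach \<Rightarrow> 'x) rmul ip X adj C.
      octonion_hilbert_space lmul rmul ip X \<longrightarrow>
      adj \<in> {K_adjoint ip, re_adjoint ip} \<longrightarrow>
      operator_cstar_algebra lmul rmul adj C \<longrightarrow>
        (\<forall>T \<in> unit_ball (cl_s C). T \<in> cl_s (unit_ball C)) \<and>
        (\<forall>T \<in> unit_ball (cl_s C). adj T T \<longrightarrow> T \<in> cl_s {A \<in> unit_ball C. adj A A}))"
proof (intro conjI allI impI ballI)
  fix lmul :: "quat \<Rightarrow> 'x::banach \<Rightarrow> 'x" and rmul ip X adj C T
  assume H: "quaternion_hilbert_space lmul rmul ip X"
    and *: "adj \<in> {K_adjoint ip, re_adjoint ip}" "operator_cstar_algebra lmul rmul adj C"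
      "T \<in> unit_ball (cl_s C)"
  interpret quaternion_hilbert_space lmul rmul ip X by (rule H)
  note density = kaplansky_density_hypercomplex[OF _ _ _ _ *]
  show "T \<in> cl_s (unit_ball C)" by (rule density(1)) (simp_all add: quat_ops)
  show "T \<in> cl_s {A \<in> unit_ball C. adj A A}" if "adj T T"
    by (rule density(2)) (simp_all add: quat_ops that)
next
  fix lmul :: "oct \<Rightarrow> 'x::banach \<Rightarrow> 'x" and rmul ip X adj C T
  assume H: "octonion_hilbert_space lmul rmul ip X"
    and *: "adj \<in> {K_adjoint ip, re_adjoint ip}" "operator_cstar_algebra lmul rmul adj C"
      "T \<in> unit_ball (cl_s C)"
  interpret octonion_hilbert_space lmul rmul ip X by (rule H)
  note density = kaplansky_density_hypercomplex[OF _ _ _ _ *]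
  show "T \<in> cl_s (unit_ball C)" by (rule density(1)) (simp_all add: oct_ops quat_ops)
  show "T \<in> cl_s {A \<in> unit_ball C. adj A A}" if "adj T T"
    by (rule density(2)) (simp_all add: oct_ops quat_ops that)
qed

end
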